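(* Every simple compact Hausdorff topological semiring is finite.
   Context: A semiring is an algebra $(R,+,\cdot,0)$ such that $(R,+,0)$ is a commutative monoid, $(R,\cdot)$ is a semigroup (no multiplicative identity is required), multiplication distributes over addition on both sides, and $0\cdot x = x\cdot 0 = 0$ for all $x\in R$. A homomorphism of semirings is a map that is a homomorphism of the additive monoids and of the multiplicative semigroups. A topological semiring is a semiring with a topology in which addition and multiplication are continuous. A Hausdorff topological semiring $R$ is called simple if every non-constant continuous semiring homomorphism from $R$ into any Hausdorff topological semiring is injective. *)

theory Defs
  imports "HOL-Analysis.Analysis"
begin

definition semiring_on :: "'a set \<Rightarrow> ('a \<Rightarrow> 'a \<Rightarrow> 'a) \<Rightarrow> ('a \<Rightarrow> 'a \<Rightarrow> 'a) \<Rightarrow> 'a \<Rightarrow> bool" where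
  "semiring_on R add mul z \<longleftrightarrow>
     z \<in> R \<and>
     (\<forall>x\<in>R. \<forall>y\<in>R. add x y \<in> R \<and> mul x y \<in> R) \<and>
     (\<forall>x\<in>R. \<forall>y\<in>R. \<forall>w\<in>R. add (add x y) w = add x (add y w)) \<and>
     (\<forall>x\<in>R. \<forall>y\<in>R. add x y = add y x) \<and>
     (\<forall>x\<in>R. add z x = x) \<and>
     (\<forall>x\<in>R. \<forall>y\<in>R. \<forall>w\<in>R. mul (mul x y) w = mul x (mul y w)) \<and>
     (\<forall>x\<in>R. \<forall>y\<in>R. \<forall>w\<in>R. mul x (add y w) = add (mul x y) (mul x w)) \<and>
     (\<forall>x\<in>R. \<forall>y\<in>R. \<forall>w\<in>R. mul (add x y) w = add (mul x w) (mul y w)) \<and>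
     (\<forall>x\<in>R. mul z x = z \<and> mul x z = z)"

definition topological_semiring :: "'a topology \<Rightarrow> ('a \<Rightarrow> 'a \<Rightarrow> 'a) \<Rightarrow> ('a \<Rightarrow> 'a \<Rightarrow> 'a) \<Rightarrow> 'a \<Rightarrow> bool" where
  "topological_semiring T add mul z \<longleftrightarrow>
     semiring_on (topspace T) add mul z \<and>
     continuous_map (prod_topology T T) T (\<lambda>(x, y). add x y) \<and>
     continuous_map (prod_topology T T) T (\<lambda>(x, y). mul x y)"

definition semiring_hom ::
  "'a set \<Rightarrow> ('a \<Rightarrow> 'a \<Rightarrow> 'a) \<Rightarrow> ('a \<Rightarrow> 'a \<Rightarrow> 'a) \<Rightarrow> 'a \<Rightarrow>
   'b set \<Rightarrow> ('b \<Rightarrow> 'b \<Rightarrow> 'b) \<Rightarrow> ('b \<Rightarrow> 'b \<Rightarrow> 'b) \<Rightarrow> 'b \<Rightarrow> ('a \<Rightarrow> 'b) \<Rightarrow> bool" where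
  "semiring_hom R add mul z S add' mul' z' f \<longleftrightarrow>
     f ` R \<subseteq> S \<and> f z = z' \<and>
     (\<forall>x\<in>R. \<forall>y\<in>R. f (add x y) = add' (f x) (f y) \<and> f (mul x y) = mul' (f x) (f y))"

definition simple_top_semiring :: "'a topology \<Rightarrow> ('a \<Rightarrow> 'a \<Rightarrow> 'a) \<Rightarrow> ('a \<Rightarrow> 'a \<Rightarrow> 'a) \<Rightarrow> 'a \<Rightarrow> bool" where
  "simple_top_semiring T add mul z \<longleftrightarrow>
     Hausdorff_space T \<and> topological_semiring T add mul z \<and>
     (\<forall>(T' :: 'a topology) add' mul' z' f.
        Hausdorff_space T' \<and> topological_semiring T' add' mul' z' \<and>
        continuous_map T T' f \<and>
        semiring_hom (topspace T) add mul z (topspace T') add' mul' z' f \<and>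
        (\<exists>x\<in>topspace T. \<exists>y\<in>topspace T. f x \<noteq> f y)
        \<longrightarrow> inj_on f (topspace T))"

end

theory Submission
  imports Defs
begin

text \<open>
  Simplicity says that every closed congruence of \<open>R\<close> is the identity or everything. Compactness makes
  many congruences closed. The syntactic congruence of a clopen set is even open, so \<open>R\<close> is finite
  as soon as it is disconnected.

  Let \<open>x \<preceq> y\<close> mean \<open>x + c = y\<close> for some \<open>c\<close>. The equivalence induced by this preorder is a closed
  congruence. If it is the identity, then \<open>R\<close> has a greatest element \<open>w\<close>, every nonzero closed ideal
  contains \<open>w\<close>, and (unless multiplication vanishes, when \<open>R = {0, w}\<close>) this forces \<open>w x w = w\<close>
  for all \<open>x \<noteq> 0\<close>; so \<open>0\<close> is isolated.

  Otherwise \<open>R\<close> is a ring, and multiplication by \<open>n \<ge> 1\<close> is zero for some \<open>n\<close> or bijective for all.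
  In the first case Bogolyubov's lemma on finite groups of exponent \<open>n\<close> and compactness yield a proper
  open subgroup. In the second case recurrence of the multiples of \<open>x\<close> near \<open>0\<close> gives \<open>x R = 0\<close>, so \<open>R\<close>
  has no proper nontrivial closed subgroups, which division by integers contradicts.
\<close>

section \<open>Closed congruences\<close>

text \<open>Since no multiplicative identity is assumed, a ring with vanishing multiplication is a
  genuine case. There ideals are just subgroups, so the ring half of the proof must find its clopen
  set with additive tools alone.

  In the torsion case the obstacle is to find any proper subgroup at all close to zero. Finite
  Fourier analysis on \<open>(Z/n)^F\<close>, for finite \<open>F\<close> in \<open>R\<close>,
  supplies characters whose number is bounded by the square of the number of translates of a small
  neighbourhood that cover \<open>R\<close>. The bound does not depend on \<open>F\<close>; this
  uniformity is what allows Tychonoff's theorem to pass from finite sets to \<open>R\<close>. The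
  characters live on coordinates and not on \<open>R\<close>, so they survive only as a colouring of
  \<open>R\<close>, and the subgroup is recovered from sums of lists whose colours cancel.

  In the divisible case there is no norm to measure contraction. The number of initial multiples of
  a point that stay in a fixed neighbourhood takes the place of an inverse norm, and division by a
  suitable \<open>M\<close> doubles it.\<close>

lemma openin_ball_compact:
  assumes "openin (prod_topology X Y) W" "compact_space Y"
  shows "openin X {x \<in> topspace X. \<forall>y\<in>topspace Y. (x, y) \<in> W}"
proof -
  have "closedin (prod_topology X Y) (topspace (prod_topology X Y) - W)"
    using assms(1) by blast
  \<comment> \<open>Tube lemma: the bad \<open>x\<close> form the projection of a closed set along a
    compact factor, hence a closed set.\<close>
  then have "closedin X (fst ` (topspace (prod_topology X Y) - W))"
    using closed_map_fst[OF assms(2)] unfolding closed_map_def by blast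
  then have "openin X (topspace X - fst ` (topspace (prod_topology X Y) - W))"
    by blast
  moreover have "topspace X - fst ` (topspace (prod_topology X Y) - W)
      = {x \<in> topspace X. \<forall>y\<in>topspace Y. (x, y) \<in> W}"
    by (force simp: image_iff)
  ultimately show ?thesis by simp
qed

lemma quotient_topology_exists:
  fixes X :: "'a topology" and q :: "'a \<Rightarrow> 'b"
  obtains Y where "quotient_map X Y q"
proof -
  let ?P = "\<lambda>U. U \<subseteq> q ` topspace X \<and> openin X {x \<in> topspace X. q x \<in> U}"
  have ist: "istopology ?P"
    unfolding istopology_def
  proof (intro conjI allI impI)
    fix S U assume S: "?P S" and U: "?P U"
    then have "openin X ({x \<in> topspace X. q x \<in> S} \<inter> {x \<in> topspace X. q x \<in> U})"
      by blast
    then show "openin X {x \<in> topspace X. q x \<in> S \<inter> U}"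
      by (rule back_subst[of "openin X"]) auto
  next
    fix \<K> assume *: "\<forall>K\<in>\<K>. ?P K"
    then have "openin X (\<Union>K\<in>\<K>. {x \<in> topspace X. q x \<in> K})"
      by blast
    then show "openin X {x \<in> topspace X. q x \<in> \<Union>\<K>}"
      by (rule back_subst[of "openin X"]) auto
  qed auto
  define Y where "Y = topology ?P"
  have op: "openin Y = ?P"
    unfolding Y_def using ist by (rule topology_inverse')
  have "topspace Y = q ` topspace X"
  proof
    show "topspace Y \<subseteq> q ` topspace X"
      using op openin_topspace[of Y] by simp
    have "{x \<in> topspace X. q x \<in> q ` topspace X} = topspace X" by auto
    then have "openin Y (q ` topspace X)"
      unfolding op by simp
    then show "q ` topspace X \<subseteq> topspace Y"
      by (rule openin_subset)
  qed
  then have "quotient_map X Y q"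
    unfolding quotient_map_def op by auto
  then show thesis by (rule that)
qed

text \<open>The saturation of a closed \<open>C\<close> is the projection of
  \<open>E \<inter> topspace X \<times> C\<close> along a compact factor, hence closed; and
  closedness in a quotient is closedness of the preimage.\<close>

lemma closed_equivalence_closed_map:
  assumes "compact_space X" "closedin (prod_topology X X) E" "equiv (topspace X) E"
    and q: "quotient_map X Y q"
    and ker: "\<And>x y. x \<in> topspace X \<Longrightarrow> y \<in> topspace X \<Longrightarrow> q x = q y \<longleftrightarrow> (x, y) \<in> E"
  shows "closed_map X Y q"
  unfolding closed_map_def
proof (intro allI impI)
  fix C assume C: "closedin X C"
  have "closedin (prod_topology X X) (E \<inter> topspace X \<times> C)"
    using assms(2) C by (intro closedin_Int) (simp_all add: closedin_prod_Times_iff)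
  then have "closedin X (fst ` (E \<inter> topspace X \<times> C))"
    using closed_map_fst[OF assms(1)] unfolding closed_map_def by blast
  moreover have "fst ` (E \<inter> topspace X \<times> C) = {x \<in> topspace X. q x \<in> q ` C}"
  proof -
    have CX: "C \<subseteq> topspace X" using C by (rule closedin_subset)
    have EX: "E \<subseteq> topspace X \<times> topspace X"
      using closedin_subset[OF assms(2)] by simp
    show ?thesis
    proof (intro equalityI subsetI)
      fix x assume "x \<in> fst ` (E \<inter> topspace X \<times> C)"
      then obtain y where y: "(x, y) \<in> E" "y \<in> C" by force
      then have "q x = q y" using ker EX by blast
      then show "x \<in> {x \<in> topspace X. q x \<in> q ` C}" using y EX by blast
    next
      fix x assume "x \<in> {x \<in> topspace X. q x \<in> q ` C}"
      then obtain y where "x \<in> topspace X" "y \<in> C" "q x = q y" by blast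
      then have "(x, y) \<in> E \<inter> topspace X \<times> C" using ker CX by blast
      then show "x \<in> fst ` (E \<inter> topspace X \<times> C)" by force
    qed
  qed
  moreover have "q ` C \<subseteq> topspace Y"
    using q C closedin_subset unfolding quotient_map_def by blast
  ultimately show "closedin Y (q ` C)"
    using q unfolding quotient_map_closedin by simp
qed

lemma finite_if_open_singletons:
  assumes "compact_space X" "\<And>x. x \<in> topspace X \<Longrightarrow> openin X {x}"
  shows "finite (topspace X)"
proof -
  have "X = discrete_topology (topspace X)"
    using assms(2) discrete_topology_unique by metis
  then show ?thesis
    using assms(1) compact_space_discrete_topology by metis
qed

text \<open>Variants in lambda form, so that \<open>cont_intros\<close> proves continuity of
  explicit terms by plain resolution.\<close>

lemma continuous_map_fst_comp:
  "continuous_map Z (prod_topology X Y) f \<Longrightarrow> continuous_map Z X (\<lambda>x. fst (f x))"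
  using continuous_map_fst_of by (simp add: o_def)

lemma continuous_map_snd_comp:
  "continuous_map Z (prod_topology X Y) f \<Longrightarrow> continuous_map Z Y (\<lambda>x. snd (f x))"
  using continuous_map_snd_of by (simp add: o_def)

lemma continuous_map_ident_fun: "continuous_map X X (\<lambda>x. x)"
  using continuous_map_id by (simp add: id_def)

lemma continuous_map_const_fun: "c \<in> topspace Y \<Longrightarrow> continuous_map X Y (\<lambda>x. c)"
  by simp

section \<open>Compact semirings and their quotients by closed congruences\<close>

locale compact_semiring =
  fixes T :: "'a topology"
    and add :: "'a \<Rightarrow> 'a \<Rightarrow> 'a" (infixl "\<oplus>" 65)
    and mul :: "'a \<Rightarrow> 'a \<Rightarrow> 'a" (infixl "\<odot>" 70)
    and z :: 'a ("\<zero>")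
  assumes compact: "compact_space T"
    and Hausdorff: "Hausdorff_space T"
    and top_semiring: "topological_semiring T add mul z"
begin

abbreviation R where "R \<equiv> topspace T"

lemma zero_closed [simp, intro]: "\<zero> \<in> R"
  and add_closed [simp, intro]: "x \<in> R \<Longrightarrow> y \<in> R \<Longrightarrow> x \<oplus> y \<in> R"
  and mul_closed [simp, intro]: "x \<in> R \<Longrightarrow> y \<in> R \<Longrightarrow> x \<odot> y \<in> R"
  and add_assoc: "x \<in> R \<Longrightarrow> y \<in> R \<Longrightarrow> w \<in> R \<Longrightarrow> x \<oplus> y \<oplus> w = x \<oplus> (y \<oplus> w)"
  and add_commute: "x \<in> R \<Longrightarrow> y \<in> R \<Longrightarrow> x \<oplus> y = y \<oplus> x"
  and add_0_left [simp]: "x \<in> R \<Longrightarrow> \<zero> \<oplus> x = x"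
  and mul_assoc: "x \<in> R \<Longrightarrow> y \<in> R \<Longrightarrow> w \<in> R \<Longrightarrow> x \<odot> y \<odot> w = x \<odot> (y \<odot> w)"
  and distrib_left: "x \<in> R \<Longrightarrow> y \<in> R \<Longrightarrow> w \<in> R \<Longrightarrow> x \<odot> (y \<oplus> w) = x \<odot> y \<oplus> x \<odot> w"
  and distrib_right: "x \<in> R \<Longrightarrow> y \<in> R \<Longrightarrow> w \<in> R \<Longrightarrow> (x \<oplus> y) \<odot> w = x \<odot> w \<oplus> y \<odot> w"
  and mul_0_left [simp]: "x \<in> R \<Longrightarrow> \<zero> \<odot> x = \<zero>"
  and mul_0_right [simp]: "x \<in> R \<Longrightarrow> x \<odot> \<zero> = \<zero>"
  using top_semiring unfolding topological_semiring_def semiring_on_def by blast+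

lemma add_0_right [simp]: "x \<in> R \<Longrightarrow> x \<oplus> \<zero> = x"
  using add_commute[of x \<zero>] by simp

lemma add_left_commute: "x \<in> R \<Longrightarrow> y \<in> R \<Longrightarrow> w \<in> R \<Longrightarrow> x \<oplus> (y \<oplus> w) = y \<oplus> (x \<oplus> w)"
  using add_assoc[of x y w] add_assoc[of y x w] add_commute[of x y] by simp

lemmas add_ac = add_assoc add_commute add_left_commute

lemma continuous_map_add:
  assumes "continuous_map X T f" "continuous_map X T g"
  shows "continuous_map X T (\<lambda>x. f x \<oplus> g x)"
proof -
  have "continuous_map X (prod_topology T T) (\<lambda>x. (f x, g x))"
    using assms by (simp add: continuous_map_pairedI)
  moreover have "continuous_map (prod_topology T T) T (\<lambda>(x, y). x \<oplus> y)"
    using top_semiring unfolding topological_semiring_def by simp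
  ultimately show ?thesis
    using continuous_map_compose by (fastforce simp: o_def)
qed

lemma continuous_map_mul:
  assumes "continuous_map X T f" "continuous_map X T g"
  shows "continuous_map X T (\<lambda>x. f x \<odot> g x)"
proof -
  have "continuous_map X (prod_topology T T) (\<lambda>x. (f x, g x))"
    using assms by (simp add: continuous_map_pairedI)
  moreover have "continuous_map (prod_topology T T) T (\<lambda>(x, y). x \<odot> y)"
    using top_semiring unfolding topological_semiring_def by simp
  ultimately show ?thesis
    using continuous_map_compose by (fastforce simp: o_def)
qed

lemmas cont_intros = continuous_map_add continuous_map_mul continuous_map_pairedI
  continuous_map_fst_comp continuous_map_snd_comp continuous_map_const_fun continuous_map_ident_fun

lemma closedin_equaliser:
  assumes "continuous_map X T f" "continuous_map X T g"
  shows "closedin X {x \<in> topspace X. f x = g x}"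
  using closedin_continuous_maps_eq[OF Hausdorff assms] .

lemma closedin_image:
  assumes "continuous_map T T f" "closedin T C"
  shows "closedin T (f ` C)"
  using continuous_imp_closed_map[OF assms(1) compact Hausdorff] assms(2)
  unfolding closed_map_def by blast

text \<open>Compatibility is asked in one argument at a time, and for addition on one side only.
  Transitivity and commutativity turn this into compatibility in both arguments, while each
  condition stays easy to check for a concrete relation.\<close>

definition closed_congruence :: "('a \<times> 'a) set \<Rightarrow> bool" where
  "closed_congruence E \<longleftrightarrow> closedin (prod_topology T T) E \<and> equiv R E \<and>
     (\<forall>x y c. (x, y) \<in> E \<longrightarrow> c \<in> R \<longrightarrow>
        (c \<oplus> x, c \<oplus> y) \<in> E \<and> (c \<odot> x, c \<odot> y) \<in> E \<and> (x \<odot> c, y \<odot> c) \<in> E)"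

lemma closed_congruenceI:
  assumes "closedin (prod_topology T T) E"
    and "\<And>x. x \<in> R \<Longrightarrow> (x, x) \<in> E"
    and "\<And>x y. (x, y) \<in> E \<Longrightarrow> (y, x) \<in> E"
    and "\<And>x y w. (x, y) \<in> E \<Longrightarrow> (y, w) \<in> E \<Longrightarrow> (x, w) \<in> E"
    and "\<And>x y c. (x, y) \<in> E \<Longrightarrow> c \<in> R \<Longrightarrow> (c \<oplus> x, c \<oplus> y) \<in> E"
    and "\<And>x y c. (x, y) \<in> E \<Longrightarrow> c \<in> R \<Longrightarrow> (c \<odot> x, c \<odot> y) \<in> E"
    and "\<And>x y c. (x, y) \<in> E \<Longrightarrow> c \<in> R \<Longrightarrow> (x \<odot> c, y \<odot> c) \<in> E"
  shows "closed_congruence E"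
proof -
  have "E \<subseteq> R \<times> R" using closedin_subset[OF assms(1)] by simp
  then have "equiv R E"
    by (intro equivI refl_onI symI transI) (simp_all add: assms(2), (erule assms(3), erule (1) assms(4))?)
  with assms(1,5,6,7) show ?thesis
    unfolding closed_congruence_def by simp
qed

lemma closed_congruenceD:
  assumes "closed_congruence E"
  shows "closedin (prod_topology T T) E" "equiv R E"
    and "(x, y) \<in> E \<Longrightarrow> c \<in> R \<Longrightarrow> (c \<oplus> x, c \<oplus> y) \<in> E"
    and "(x, y) \<in> E \<Longrightarrow> c \<in> R \<Longrightarrow> (c \<odot> x, c \<odot> y) \<in> E"
    and "(x, y) \<in> E \<Longrightarrow> c \<in> R \<Longrightarrow> (x \<odot> c, y \<odot> c) \<in> E"
  using assms unfolding closed_congruence_def by iprover+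

lemma closed_congruence_subset: "closed_congruence E \<Longrightarrow> E \<subseteq> R \<times> R"
  by (drule closed_congruenceD(1)[THEN closedin_subset]) simp

text \<open>Simplicity quantifies over topologies on the carrier type only, so the quotient is
  modelled on representatives chosen in \<open>R\<close> instead of on classes. It is Hausdorff
  because the projection is a closed map and closed continuous images of normal Hausdorff spaces are
  Hausdorff.\<close>

lemma closed_congruence_quotient:
  assumes E: "closed_congruence E"
  obtains T' :: "'a topology" and add' mul' z' q where
    "Hausdorff_space T'" "topological_semiring T' add' mul' z'" "continuous_map T T' q"
    "semiring_hom R add mul z (topspace T') add' mul' z' q"
    "\<And>x y. x \<in> R \<Longrightarrow> y \<in> R \<Longrightarrow> q x = q y \<longleftrightarrow> (x, y) \<in> E"
proof -
  have eqv: "equiv R E" and clo: "closedin (prod_topology T T) E"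
    using closed_congruenceD(1,2)[OF E] by simp_all
  \<comment> \<open>The choice depends on \<open>x\<close> only through the predicate of its class,
    so equivalent points get the same representative.\<close>
  define q where "q = (\<lambda>x. SOME y. (x, y) \<in> E)"
  have qE: "(x, q x) \<in> E" if "x \<in> R" for x
    unfolding q_def by (rule someI[of _ x]) (use eqv that in \<open>simp add: equiv_def refl_on_def\<close>)
  have symE: "(x, y) \<in> E \<Longrightarrow> (y, x) \<in> E" and transE: "(x, y) \<in> E \<Longrightarrow> (y, w) \<in> E \<Longrightarrow> (x, w) \<in> E"
    for x y w
    using eqv unfolding equiv_def sym_def trans_def by blast+
  have ker: "q x = q y \<longleftrightarrow> (x, y) \<in> E" if "x \<in> R" "y \<in> R" for x y
  proof
    assume "q x = q y"
    then show "(x, y) \<in> E" using qE[OF that(1)] qE[OF that(2)] symE transE by metis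
  next
    assume "(x, y) \<in> E"
    then have "(\<lambda>w. (x, w) \<in> E) = (\<lambda>w. (y, w) \<in> E)" using symE transE by blast
    then show "q x = q y" unfolding q_def by simp
  qed
  have qR: "q x \<in> R" if "x \<in> R" for x
    using qE[OF that] closed_congruence_subset[OF E] by blast
  have add_cong: "(x \<oplus> u, y \<oplus> v) \<in> E" and mul_cong: "(x \<odot> u, y \<odot> v) \<in> E"
    if "(x, y) \<in> E" "(u, v) \<in> E" for x y u v
  proof -
    have R: "x \<in> R" "y \<in> R" "u \<in> R" "v \<in> R"
      using that closed_congruence_subset[OF E] by auto
    have "(u \<oplus> x, u \<oplus> y) \<in> E" "(y \<oplus> u, y \<oplus> v) \<in> E" "(x \<odot> u, y \<odot> u) \<in> E" "(y \<odot> u, y \<odot> v) \<in> E"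
      using that R by (simp_all add: closed_congruenceD[OF E])
    then show "(x \<oplus> u, y \<oplus> v) \<in> E" "(x \<odot> u, y \<odot> v) \<in> E"
      using transE add_commute R by metis+
  qed
  obtain T' where quot: "quotient_map T T' q" by (rule quotient_topology_exists)
  have sp: "topspace T' = q ` R" using quot unfolding quotient_map_def by simp
  have cont: "continuous_map T T' q" using quot by (rule quotient_imp_continuous_map)
  have "closed_map T T' q"
    using closed_equivalence_closed_map[OF compact clo eqv quot] ker by blast
  then have haus: "Hausdorff_space T'"
    using normal_Hausdorff_space_closed_continuous_map_image[of T T' q] cont sp compact Hausdorff
      compact_Hausdorff_or_regular_imp_normal_space by metis
  define add' where "add' = (\<lambda>x y. q (x \<oplus> y))"
  define mul' where "mul' = (\<lambda>x y. q (x \<odot> y))"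
  have add'q: "add' (q x) (q y) = q (x \<oplus> y)" if "x \<in> R" "y \<in> R" for x y
    unfolding add'_def using ker[of "x \<oplus> y" "q x \<oplus> q y"] add_cong[OF qE qE] that qR by simp
  have mul'q: "mul' (q x) (q y) = q (x \<odot> y)" if "x \<in> R" "y \<in> R" for x y
    unfolding mul'_def using ker[of "x \<odot> y" "q x \<odot> q y"] mul_cong[OF qE qE] that qR by simp
  \<comment> \<open>The square of \<open>q\<close> is again a quotient map, as a continuous
    surjection from a compact space onto a Hausdorff one. This lets the continuity of both
    operations descend.\<close>
  have pq: "quotient_map (prod_topology T T) (prod_topology T' T') (\<lambda>(x, y). (q x, q y))"
  proof (rule continuous_imp_quotient_map)
    show "continuous_map (prod_topology T T) (prod_topology T' T') (\<lambda>(x, y). (q x, q y))"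
      using cont continuous_map_prod_top by blast
    show "compact_space (prod_topology T T)" using compact by (simp add: compact_space_prod_topology)
    show "Hausdorff_space (prod_topology T' T')" using haus by (simp add: Hausdorff_space_prod_topology)
    show "(\<lambda>(x, y). (q x, q y)) ` topspace (prod_topology T T) = topspace (prod_topology T' T')"
      by (force simp: sp)
  qed
  have cadd: "continuous_map (prod_topology T' T') T' (\<lambda>(x, y). add' x y)"
  proof (rule continuous_compose_quotient_map[OF pq])
    have "continuous_map (prod_topology T T) T' (q \<circ> (\<lambda>(x, y). x \<oplus> y))"
      using cont top_semiring unfolding topological_semiring_def by (meson continuous_map_compose)
    then show "continuous_map (prod_topology T T) T' ((\<lambda>(x, y). add' x y) \<circ> (\<lambda>(x, y). (q x, q y)))"
      by (rule continuous_map_eq) (auto simp: add'q)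
  qed
  have cmul: "continuous_map (prod_topology T' T') T' (\<lambda>(x, y). mul' x y)"
  proof (rule continuous_compose_quotient_map[OF pq])
    have "continuous_map (prod_topology T T) T' (q \<circ> (\<lambda>(x, y). x \<odot> y))"
      using cont top_semiring unfolding topological_semiring_def by (meson continuous_map_compose)
    then show "continuous_map (prod_topology T T) T' ((\<lambda>(x, y). mul' x y) \<circ> (\<lambda>(x, y). (q x, q y)))"
      by (rule continuous_map_eq) (auto simp: mul'q)
  qed
  have "semiring_on (topspace T') add' mul' (q \<zero>)"
    unfolding semiring_on_def sp
    by (intro conjI ballI; (elim imageE)?; simp add: add'q mul'q add_assoc mul_assoc distrib_left distrib_right)
       (simp add: add_commute)
  then have "topological_semiring T' add' mul' (q \<zero>)"
    unfolding topological_semiring_def using cadd cmul by blast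
  moreover have "semiring_hom R add mul z (topspace T') add' mul' (q \<zero>) q"
    unfolding semiring_hom_def sp by (simp add: add'q mul'q)
  ultimately show thesis
    using that haus cont ker by blast
qed

end

text \<open>Once derived, this dichotomy is the only form in which simplicity is applied.\<close>

locale simple_compact_semiring = compact_semiring +
  assumes simple: "closed_congruence E \<Longrightarrow> E \<subseteq> Id \<or> E = R \<times> R"

lemma simple_compact_semiringI:
  assumes "simple_top_semiring T add mul z" "compact_space T"
  shows "simple_compact_semiring T add mul z"
proof -
  interpret compact_semiring T add mul z
    using assms unfolding simple_top_semiring_def by unfold_locales auto
  show ?thesis
  proof
    fix E assume E: "closed_congruence E"
    obtain T' :: "'a topology" and add' mul' z' q where q:
      "Hausdorff_space T'" "topological_semiring T' add' mul' z'" "continuous_map T T' q"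
      "semiring_hom R add mul z (topspace T') add' mul' z' q"
      "\<And>x y. x \<in> R \<Longrightarrow> y \<in> R \<Longrightarrow> q x = q y \<longleftrightarrow> (x, y) \<in> E"
      using closed_congruence_quotient[OF E] by metis
    have ER: "E \<subseteq> R \<times> R" using E by (rule closed_congruence_subset)
    show "E \<subseteq> Id \<or> E = R \<times> R"
    proof (cases "\<exists>x\<in>R. \<exists>y\<in>R. q x \<noteq> q y")
      case True
      then have "inj_on q R"
        using assms(1) q unfolding simple_top_semiring_def by blast
      then have "E \<subseteq> Id"
        using ER q(5) unfolding inj_on_def by blast
      then show ?thesis ..
    next
      case False
      then have "E = R \<times> R" using ER q(5) by blast
      then show ?thesis ..
    qed
  qed
qed

section \<open>Syntactic congruences of clopen sets and Bourne congruences of ideals\<close>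

context simple_compact_semiring
begin

text \<open>Quantifying over a compact parameter space preserves openness. The space
  \<open>Y\<close> is kept general because the two-sided products
  \<open>a \<odot> x \<odot> b\<close> are indexed by a pair.\<close>

lemma openin_ball_pairs:
  assumes P: "openin (prod_topology T T) P" and Y: "compact_space Y"
    and f: "continuous_map (prod_topology T Y) T (\<lambda>(x, c). f x c)"
  shows "openin (prod_topology T T) {(x, y) \<in> R \<times> R. \<forall>c\<in>topspace Y. (f x c, f y c) \<in> P}"
proof -
  let ?h = "\<lambda>((x, y), c). (f x c, f y c)"
  have "continuous_map (prod_topology (prod_topology T T) Y) (prod_topology T Y) (\<lambda>w. (fst (fst w), snd w))"
       "continuous_map (prod_topology (prod_topology T T) Y) (prod_topology T Y) (\<lambda>w. (snd (fst w), snd w))"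
    by (rule cont_intros)+
  from this[THEN continuous_map_compose[OF _ f]]
  have "continuous_map (prod_topology (prod_topology T T) Y) T (\<lambda>w. f (fst (fst w)) (snd w))"
       "continuous_map (prod_topology (prod_topology T T) Y) T (\<lambda>w. f (snd (fst w)) (snd w))"
    by (simp_all add: o_def)
  then have "continuous_map (prod_topology (prod_topology T T) Y) (prod_topology T T) ?h"
    by (simp add: case_prod_unfold continuous_map_pairedI)
  then have "openin (prod_topology (prod_topology T T) Y) {w \<in> topspace (prod_topology (prod_topology T T) Y). ?h w \<in> P}"
    using P by (rule openin_continuous_map_preimage)
  from openin_ball_compact[OF this Y]
  show ?thesis by (rule back_subst[of "openin (prod_topology T T)"]) auto
qed

text \<open>The syntactic congruence of a clopen set is clopen, so it can only be the identity,
  and then the topology is discrete.\<close>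

lemma finite_if_clopen:
  assumes A: "openin T A" "closedin T A" and x0: "x0 \<in> A" and x1: "x1 \<in> R" "x1 \<notin> A"
  shows "finite R"
proof -
  have AR: "A \<subseteq> R" using A(1) by (rule openin_subset)
  let ?TT = "prod_topology T T"
  define E0 where "E0 = {(x, y) \<in> R \<times> R. \<forall>c\<in>R. c \<oplus> x \<in> A \<longleftrightarrow> c \<oplus> y \<in> A}"
  \<comment> \<open>Without a multiplicative identity the contexts \<open>x\<close>,
    \<open>a \<odot> x\<close>, \<open>x \<odot> b\<close> and \<open>a \<odot> x \<odot> b\<close>
    are not instances of one another. \<open>E0\<close> takes care of added terms; distributivity
    pulls sums out of products, so no deeper contexts arise.\<close>
  define E where "E = {(x, y) \<in> R \<times> R. (x, y) \<in> E0 \<and> (\<forall>a\<in>R. (a \<odot> x, a \<odot> y) \<in> E0) \<and>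
     (\<forall>b\<in>R. (x \<odot> b, y \<odot> b) \<in> E0) \<and> (\<forall>a\<in>R. \<forall>b\<in>R. (a \<odot> x \<odot> b, a \<odot> y \<odot> b) \<in> E0)}"
  have "openin ?TT (A \<times> A \<union> (R - A) \<times> (R - A))"
    using A by (intro openin_Un) (simp_all add: openin_prod_Times_iff openin_diff)
  moreover have "continuous_map ?TT T (\<lambda>(x, c). c \<oplus> x)"
    unfolding case_prod_unfold by (rule cont_intros)+
  ultimately have "openin ?TT {(x, y) \<in> R \<times> R. \<forall>c\<in>R. (c \<oplus> x, c \<oplus> y) \<in> A \<times> A \<union> (R - A) \<times> (R - A)}"
    by (rule openin_ball_pairs[OF _ compact])
  then have opE0: "openin ?TT E0"
    by (rule back_subst[of "openin ?TT"]) (auto simp: E0_def)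
  have "openin ?TT {(x, y) \<in> R \<times> R. \<forall>a\<in>R. (a \<odot> x, a \<odot> y) \<in> E0}"
  proof (rule openin_ball_pairs[OF opE0 compact])
    show "continuous_map ?TT T (\<lambda>(x, a). a \<odot> x)"
      unfolding case_prod_unfold by (rule cont_intros)+
  qed
  moreover have "openin ?TT {(x, y) \<in> R \<times> R. \<forall>b\<in>R. (x \<odot> b, y \<odot> b) \<in> E0}"
  proof (rule openin_ball_pairs[OF opE0 compact])
    show "continuous_map ?TT T (\<lambda>(x, b). x \<odot> b)"
      unfolding case_prod_unfold by (rule cont_intros)+
  qed
  moreover have "openin ?TT {(x, y) \<in> R \<times> R. \<forall>c\<in>topspace ?TT. (fst c \<odot> x \<odot> snd c, fst c \<odot> y \<odot> snd c) \<in> E0}"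
  proof (rule openin_ball_pairs[OF opE0])
    show "compact_space ?TT" using compact by (simp add: compact_space_prod_topology)
    show "continuous_map (prod_topology T ?TT) T (\<lambda>(x, c). fst c \<odot> x \<odot> snd c)"
      unfolding case_prod_unfold by (rule cont_intros)+
  qed
  ultimately have "openin ?TT (E0 \<inter> {(x, y) \<in> R \<times> R. \<forall>a\<in>R. (a \<odot> x, a \<odot> y) \<in> E0} \<inter>
      {(x, y) \<in> R \<times> R. \<forall>b\<in>R. (x \<odot> b, y \<odot> b) \<in> E0} \<inter>
      {(x, y) \<in> R \<times> R. \<forall>c\<in>topspace ?TT. (fst c \<odot> x \<odot> snd c, fst c \<odot> y \<odot> snd c) \<in> E0})"
    using opE0 by blast
  then have opE: "openin ?TT E"
    by (rule back_subst[of "openin ?TT"]) (auto simp: E_def)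
  have E0_refl: "(x, x) \<in> E0" if "x \<in> R" for x
    using that unfolding E0_def by auto
  have E0_sym: "(y, x) \<in> E0" if "(x, y) \<in> E0" for x y
    using that unfolding E0_def by auto
  have E0_trans: "(x, w) \<in> E0" if "(x, y) \<in> E0" "(y, w) \<in> E0" for x y w
    using that unfolding E0_def by auto
  have E0_add: "(c \<oplus> x, c \<oplus> y) \<in> E0" if "(x, y) \<in> E0" "c \<in> R" for x y c
  proof -
    have R: "x \<in> R" "y \<in> R" using that unfolding E0_def by auto
    have "d \<oplus> (c \<oplus> x) \<in> A \<longleftrightarrow> d \<oplus> (c \<oplus> y) \<in> A" if "d \<in> R" for d
    proof -
      have "d \<oplus> c \<in> R" using that \<open>c \<in> R\<close> by simp
      then have "(d \<oplus> c) \<oplus> x \<in> A \<longleftrightarrow> (d \<oplus> c) \<oplus> y \<in> A"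
        using \<open>(x, y) \<in> E0\<close> unfolding E0_def by blast
      then show ?thesis using that R \<open>c \<in> R\<close> by (simp add: add_assoc)
    qed
    then show ?thesis unfolding E0_def using R \<open>c \<in> R\<close> by auto
  qed
  have E_refl: "(x, x) \<in> E" if "x \<in> R" for x
    using that E0_refl unfolding E_def by auto
  have E_sym: "(y, x) \<in> E" if "(x, y) \<in> E" for x y
    using that E0_sym unfolding E_def by auto
  have E_trans: "(x, w) \<in> E" if "(x, y) \<in> E" "(y, w) \<in> E" for x y w
    using that unfolding E_def by clarsimp (meson E0_trans)
  have ER: "E \<subseteq> R \<times> R" unfolding E_def by auto
  \<comment> \<open>An open equivalence relation is closed: its classes are open, and the classes of
    two inequivalent points have a product that avoids it.\<close>
  have "closedin ?TT E"
  proof -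
    have "openin ?TT (R \<times> R - E)"
    proof (subst openin_prod_topology_alt, intro allI impI)
      fix x y assume xy: "(x, y) \<in> R \<times> R - E"
      define cl where "cl = (\<lambda>x. {w \<in> R. (x, w) \<in> E})"
      have op: "openin T (cl x)" if "x \<in> R" for x
      proof -
        have "continuous_map T ?TT (\<lambda>w. (x, w))"
          using that by (auto intro: cont_intros)
        from openin_continuous_map_preimage[OF this opE] show ?thesis unfolding cl_def by simp
      qed
      have "cl x \<times> cl y \<subseteq> R \<times> R - E"
        unfolding cl_def using xy E_sym E_trans by blast
      moreover have "x \<in> cl x" "y \<in> cl y" using xy E_refl unfolding cl_def by auto
      ultimately show "\<exists>U V. openin T U \<and> openin T V \<and> x \<in> U \<and> y \<in> V \<and> U \<times> V \<subseteq> R \<times> R - E"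
        using op xy by blast
    qed
    then show ?thesis using ER by (simp add: closedin_def)
  qed
  then have "closed_congruence E"
  proof (rule closed_congruenceI)
    show "(x, x) \<in> E" if "x \<in> R" for x using that by (rule E_refl)
    show "(y, x) \<in> E" if "(x, y) \<in> E" for x y using that by (rule E_sym)
    show "(x, w) \<in> E" if "(x, y) \<in> E" "(y, w) \<in> E" for x y w using that by (rule E_trans)
    show "(c \<oplus> x, c \<oplus> y) \<in> E" if "(x, y) \<in> E" "c \<in> R" for x y c
      using that unfolding E_def by (clarsimp simp: distrib_left distrib_right E0_add)
    show "(c \<odot> x, c \<odot> y) \<in> E" if "(x, y) \<in> E" "c \<in> R" for x y c
      using that unfolding E_def by (clarsimp simp: mul_assoc[symmetric])
    show "(x \<odot> c, y \<odot> c) \<in> E" if "(x, y) \<in> E" "c \<in> R" for x y c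
      using that unfolding E_def by (clarsimp simp: mul_assoc)
  qed
  moreover have "E \<noteq> R \<times> R"
  proof
    assume "E = R \<times> R"
    then have "(x0, x1) \<in> E" using x0 x1 AR by auto
    then have "(x0, x1) \<in> E0" unfolding E_def by simp
    then have "\<zero> \<oplus> x0 \<in> A \<longleftrightarrow> \<zero> \<oplus> x1 \<in> A" unfolding E0_def by blast
    then show False using x0 x1 AR by auto
  qed
  ultimately have EId: "E \<subseteq> Id" using simple by blast
  have "openin T {x}" if "x \<in> R" for x
  proof -
    have "continuous_map T ?TT (\<lambda>w. (x, w))"
      using that by (auto intro: cont_intros)
    from openin_continuous_map_preimage[OF this opE]
    have "openin T {w \<in> R. (x, w) \<in> E}" .
    moreover have "{w \<in> R. (x, w) \<in> E} = {x}"
      using EId E_refl[OF that] that by auto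
    ultimately show ?thesis by simp
  qed
  then show ?thesis using finite_if_open_singletons compact by blast
qed

definition closed_ideal :: "'a set \<Rightarrow> bool" where
  "closed_ideal I \<longleftrightarrow> closedin T I \<and> \<zero> \<in> I \<and> (\<forall>x\<in>I. \<forall>y\<in>I. x \<oplus> y \<in> I) \<and>
     (\<forall>x\<in>I. \<forall>a\<in>R. a \<odot> x \<in> I \<and> x \<odot> a \<in> I)"

text \<open>The Bourne congruence of a closed ideal is closed by compactness.\<close>

lemma closed_ideal_cases:
  assumes I: "closed_ideal I"
  obtains "I = {\<zero>}" | "\<And>x. x \<in> R \<Longrightarrow> \<exists>i\<in>I. x \<oplus> i \<in> I"
proof -
  let ?TT = "prod_topology T T"
  have clI: "closedin T I" and 0: "\<zero> \<in> I"
    using I unfolding closed_ideal_def by auto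
  have plus: "x \<oplus> y \<in> I" if "x \<in> I" "y \<in> I" for x y
    using I that unfolding closed_ideal_def by auto
  have times: "a \<odot> x \<in> I" "x \<odot> a \<in> I" if "x \<in> I" "a \<in> R" for x a
    using I that unfolding closed_ideal_def by auto
  have IR: "I \<subseteq> R" using clI by (rule closedin_subset)
  define E where "E = {(x, y) \<in> R \<times> R. \<exists>i\<in>I. \<exists>j\<in>I. x \<oplus> i = y \<oplus> j}"
  have "closedin ?TT E"
  proof -
    let ?X = "prod_topology ?TT ?TT"
    \<comment> \<open>Quadruples \<open>((x, y), (i, j))\<close> with
      \<open>x \<oplus> i = y \<oplus> j\<close>; projecting away the compact coordinates
      \<open>(i, j)\<close> gives \<open>E\<close>.\<close>
    define W where "W = {w \<in> topspace ?X. fst (fst w) \<oplus> fst (snd w) = snd (fst w) \<oplus> snd (snd w)}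
      \<inter> (R \<times> R) \<times> (I \<times> I)"
    have "closedin ?X {w \<in> topspace ?X. fst (fst w) \<oplus> fst (snd w) = snd (fst w) \<oplus> snd (snd w)}"
      by (rule closedin_equaliser; (rule cont_intros)+)
    moreover have "closedin ?X ((R \<times> R) \<times> (I \<times> I))"
      using clI by (simp add: closedin_prod_Times_iff)
    ultimately have "closedin ?X W"
      unfolding W_def by (rule closedin_Int)
    moreover have "closed_map ?X ?TT fst"
      using compact by (intro closed_map_fst) (simp add: compact_space_prod_topology)
    ultimately have "closedin ?TT (fst ` W)" unfolding closed_map_def by blast
    moreover have "fst ` W = E"
    proof (intro equalityI subsetI)
      fix p assume "p \<in> fst ` W"
      then obtain i j where "(p, (i, j)) \<in> W" by force
      then show "p \<in> E" unfolding W_def E_def by (auto simp: case_prod_unfold)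
    next
      fix p assume "p \<in> E"
      then obtain x y i j where "p = (x, y)" "x \<in> R" "y \<in> R" "i \<in> I" "j \<in> I" "x \<oplus> i = y \<oplus> j"
        unfolding E_def by blast
      moreover from this have "i \<in> R" "j \<in> R" using IR by auto
      ultimately have "(p, (i, j)) \<in> W" unfolding W_def by simp
      then show "p \<in> fst ` W" by force
    qed
    ultimately show ?thesis by simp
  qed
  then have "closed_congruence E"
  proof (rule closed_congruenceI)
    show "(x, x) \<in> E" if "x \<in> R" for x using that 0 unfolding E_def by auto
    show "(y, x) \<in> E" if "(x, y) \<in> E" for x y using that unfolding E_def by auto metis
    show "(x, w) \<in> E" if xy: "(x, y) \<in> E" and yw: "(y, w) \<in> E" for x y w
    proof -
      from xy obtain i j where ij: "x \<in> R" "y \<in> R" "i \<in> I" "j \<in> I" "x \<oplus> i = y \<oplus> j"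
        unfolding E_def by auto
      from yw obtain k l where kl: "w \<in> R" "k \<in> I" "l \<in> I" "y \<oplus> k = w \<oplus> l"
        unfolding E_def by auto
      have R: "x \<in> R" "y \<in> R" "w \<in> R" "i \<in> R" "j \<in> R" "k \<in> R" "l \<in> R"
        using ij(1-4) kl(1-3) IR by auto
      have "x \<oplus> (i \<oplus> k) = (x \<oplus> i) \<oplus> k" using R by (simp add: add_assoc)
      also have "\<dots> = (y \<oplus> k) \<oplus> j" unfolding ij(5) using R by (simp add: add_ac)
      also have "\<dots> = w \<oplus> (l \<oplus> j)" unfolding kl(4) using R by (simp add: add_assoc)
      finally show ?thesis using ij kl plus unfolding E_def by blast
    qed
    show "(c \<oplus> x, c \<oplus> y) \<in> E" if "(x, y) \<in> E" "c \<in> R" for x y c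
    proof -
      from that obtain i j where ij: "x \<in> R" "y \<in> R" "i \<in> I" "j \<in> I" "x \<oplus> i = y \<oplus> j"
        unfolding E_def by auto
      have "c \<oplus> x \<oplus> i = c \<oplus> y \<oplus> j"
        using ij that(2) IR add_assoc by (metis subsetD)
      then show ?thesis using ij that(2) unfolding E_def by blast
    qed
    show "(c \<odot> x, c \<odot> y) \<in> E" if "(x, y) \<in> E" "c \<in> R" for x y c
    proof -
      from that obtain i j where ij: "x \<in> R" "y \<in> R" "i \<in> I" "j \<in> I" "x \<oplus> i = y \<oplus> j"
        unfolding E_def by auto
      have "c \<odot> x \<oplus> c \<odot> i = c \<odot> y \<oplus> c \<odot> j"
        using ij that(2) IR distrib_left by (metis subsetD)
      then show ?thesis using ij that(2) times unfolding E_def by blast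
    qed
    show "(x \<odot> c, y \<odot> c) \<in> E" if "(x, y) \<in> E" "c \<in> R" for x y c
    proof -
      from that obtain i j where ij: "x \<in> R" "y \<in> R" "i \<in> I" "j \<in> I" "x \<oplus> i = y \<oplus> j"
        unfolding E_def by auto
      have "x \<odot> c \<oplus> i \<odot> c = y \<odot> c \<oplus> j \<odot> c"
        using ij that(2) IR distrib_right by (metis subsetD)
      then show ?thesis using ij that(2) times unfolding E_def by blast
    qed
  qed
  then consider "E \<subseteq> Id" | "E = R \<times> R" using simple by blast
  then show thesis
  proof cases
    case 1
    have "i = \<zero>" if "i \<in> I" for i
    proof -
      have "(i, \<zero>) \<in> E" using that 0 IR unfolding E_def by force
      then show ?thesis using 1 by auto
    qed
    then have "I = {\<zero>}" using 0 by blast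
    then show thesis by (rule that(1))
  next
    case 2
    have "\<exists>i\<in>I. x \<oplus> i \<in> I" if "x \<in> R" for x
    proof -
      have "(x, \<zero>) \<in> E" using 2 that by auto
      then obtain i j where "i \<in> I" "j \<in> I" "x \<oplus> i = \<zero> \<oplus> j" unfolding E_def by auto
      then show ?thesis using IR add_0_left by (metis subsetD)
    qed
    then show thesis by (rule that(2))
  qed
qed

end

section \<open>The ordered case\<close>

context simple_compact_semiring
begin

definition le :: "'a \<Rightarrow> 'a \<Rightarrow> bool" (infix "\<preceq>" 50) where
  "x \<preceq> y \<longleftrightarrow> (\<exists>c\<in>R. x \<oplus> c = y)"

text \<open>The relation is the image of the compact square under the shear \<open>(x, c)\<close> to
  \<open>(x, x \<oplus> c)\<close>.\<close>

lemma closedin_le: "closedin (prod_topology T T) {(x, y) \<in> R \<times> R. x \<preceq> y}"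
proof -
  let ?TT = "prod_topology T T" and ?h = "\<lambda>p. (fst p, fst p \<oplus> snd p)"
  have "continuous_map ?TT ?TT ?h"
    by (rule cont_intros)+
  then have "closed_map ?TT ?TT ?h"
    using compact Hausdorff
    by (intro continuous_imp_closed_map) (simp_all add: compact_space_prod_topology Hausdorff_space_prod_topology)
  then have "closedin ?TT (?h ` topspace ?TT)"
    unfolding closed_map_def by blast
  moreover have "?h ` topspace ?TT = {(x, y) \<in> R \<times> R. x \<preceq> y}"
  proof (intro equalityI subsetI)
    fix p assume "p \<in> ?h ` topspace ?TT"
    then show "p \<in> {(x, y) \<in> R \<times> R. x \<preceq> y}" unfolding le_def by auto
  next
    fix p assume "p \<in> {(x, y) \<in> R \<times> R. x \<preceq> y}"
    then obtain x c where "p = (x, x \<oplus> c)" "x \<in> R" "c \<in> R" unfolding le_def by auto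
    then have "p = ?h (x, c)" "(x, c) \<in> topspace ?TT" by simp_all
    then show "p \<in> ?h ` topspace ?TT" by (rule image_eqI)
  qed
  ultimately show ?thesis by simp
qed

lemma closedin_le_maps:
  assumes "continuous_map X T f" "continuous_map X T g"
  shows "closedin X {x \<in> topspace X. f x \<preceq> g x}"
proof -
  have "continuous_map X (prod_topology T T) (\<lambda>x. (f x, g x))"
    using assms by (rule continuous_map_pairedI)
  from closedin_continuous_map_preimage[OF this closedin_le]
  have "closedin X {x \<in> topspace X. (f x, g x) \<in> {(x, y) \<in> R \<times> R. x \<preceq> y}}" .
  moreover have "f x \<in> R \<and> g x \<in> R" if "x \<in> topspace X" for x
    using that assms unfolding continuous_map_def by blast
  then have "{x \<in> topspace X. (f x, g x) \<in> {(x, y) \<in> R \<times> R. x \<preceq> y}} = {x \<in> topspace X. f x \<preceq> g x}"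
    by blast
  ultimately show ?thesis by simp
qed

lemma le_refl: "x \<in> R \<Longrightarrow> x \<preceq> x"
  unfolding le_def by (rule bexI[of _ \<zero>]) simp_all

lemma le_trans:
  assumes "x \<in> R" "x \<preceq> y" "y \<preceq> w" shows "x \<preceq> w"
  using assms unfolding le_def by (metis add_assoc add_closed)

lemma zero_le: "x \<in> R \<Longrightarrow> \<zero> \<preceq> x"
  unfolding le_def by force

lemma le_add_left:
  assumes "x \<in> R" "c \<in> R" "x \<preceq> y" shows "c \<oplus> x \<preceq> c \<oplus> y"
  using assms unfolding le_def by (metis add_assoc)

lemma le_add_mono:
  assumes R: "x \<in> R" "u \<in> R" "x \<preceq> y" "u \<preceq> v" shows "x \<oplus> u \<preceq> y \<oplus> v"
proof -
  have yR: "y \<in> R" using assms unfolding le_def by auto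
  have "u \<oplus> x \<preceq> u \<oplus> y" "y \<oplus> u \<preceq> y \<oplus> v"
    using assms yR by (auto intro: le_add_left)
  then show ?thesis using le_trans[of "x \<oplus> u"] R yR by (simp add: add_commute)
qed

lemma le_mul_left:
  assumes "x \<in> R" "c \<in> R" "x \<preceq> y" shows "c \<odot> x \<preceq> c \<odot> y"
  using assms unfolding le_def by (metis distrib_left mul_closed)

lemma le_mul_right:
  assumes "x \<in> R" "c \<in> R" "x \<preceq> y" shows "x \<odot> c \<preceq> y \<odot> c"
  using assms unfolding le_def by (metis distrib_right mul_closed)

text \<open>If the congruence induced by the preorder identifies everything, then
  \<open>x \<preceq> \<zero>\<close> holds for each \<open>x\<close>, and this is the existence of
  an additive inverse.\<close>

lemma ring_or_antisym:
  obtains "\<And>x. x \<in> R \<Longrightarrow> \<exists>y\<in>R. x \<oplus> y = \<zero>"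
  | "\<And>x y. x \<in> R \<Longrightarrow> y \<in> R \<Longrightarrow> x \<preceq> y \<Longrightarrow> y \<preceq> x \<Longrightarrow> x = y"
proof -
  let ?TT = "prod_topology T T"
  define E where "E = {(x, y) \<in> R \<times> R. x \<preceq> y \<and> y \<preceq> x}"
  have "closedin ?TT ({p \<in> topspace ?TT. fst p \<preceq> snd p} \<inter> {p \<in> topspace ?TT. snd p \<preceq> fst p})"
    by (rule closedin_Int; rule closedin_le_maps; (rule cont_intros)+)
  then have "closedin ?TT E"
    by (rule back_subst[of "closedin ?TT"]) (auto simp: E_def)
  then have "closed_congruence E"
    by (rule closed_congruenceI)
       (auto simp: E_def intro: le_refl le_trans le_add_left le_mul_left le_mul_right)
  then consider "E \<subseteq> Id" | "E = R \<times> R" using simple by blast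
  then show thesis
  proof cases
    case 1
    then have "x = y" if "x \<in> R" "y \<in> R" "x \<preceq> y" "y \<preceq> x" for x y
      using that unfolding E_def by blast
    then show thesis by (rule that(2))
  next
    case 2
    have "\<exists>y\<in>R. x \<oplus> y = \<zero>" if "x \<in> R" for x
    proof -
      have "(x, \<zero>) \<in> E" using 2 that by simp
      then show ?thesis unfolding E_def le_def by simp
    qed
    then show thesis by (rule that(1))
  qed
qed

text \<open>Up-sets are closed, and finitely many of them always meet because a sum lies above each
  of its terms. A point common to all of them exists by compactness.\<close>

lemma greatest_exists: obtains w where "w \<in> R" "\<And>x. x \<in> R \<Longrightarrow> x \<preceq> w"
proof -
  let ?up = "\<lambda>x. {y \<in> R. x \<preceq> y}"
  have "\<Inter>(?up ` R) \<noteq> {}"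
  proof (rule compact[unfolded compact_space_fip, rule_format], intro conjI ballI allI impI)
    fix C assume "C \<in> ?up ` R"
    then obtain x where "x \<in> R" "C = ?up x" by blast
    then show "closedin T C"
      using closedin_le_maps[of T "\<lambda>_. x" "\<lambda>y. y"] by simp
  next
    fix \<F> assume "finite \<F> \<and> \<F> \<subseteq> ?up ` R"
    then obtain F where F: "finite F" "F \<subseteq> R" "\<F> = ?up ` F"
      using finite_subset_image[of \<F> ?up R] by blast
    from F(1,2) have "\<exists>u\<in>R. \<forall>x\<in>F. x \<preceq> u"
    proof (induction F)
      case empty
      then show ?case by blast
    next
      case (insert x F)
      then obtain u where u: "u \<in> R" "\<And>y. y \<in> F \<Longrightarrow> y \<preceq> u" by auto
      have x: "x \<in> R" using insert by simp
      have "y \<preceq> x \<oplus> u" if "y \<in> insert x F" for y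
      proof (cases "y = x")
        case True
        then show ?thesis using u unfolding le_def by blast
      next
        case False
        then have "y \<preceq> u" "y \<in> R" using that u insert by auto
        moreover have "u \<preceq> x \<oplus> u" using u x add_commute unfolding le_def by metis
        ultimately show ?thesis using le_trans by blast
      qed
      then show ?case using u x by blast
    qed
    then show "\<Inter>\<F> \<noteq> {}" unfolding F(3) by blast
  qed
  then obtain w where w: "\<And>x. x \<in> R \<Longrightarrow> w \<in> R \<and> x \<preceq> w" by blast
  then show thesis using that zero_closed by blast
qed

lemma finite_if_antisym:
  assumes antisym: "\<And>x y. x \<in> R \<Longrightarrow> y \<in> R \<Longrightarrow> x \<preceq> y \<Longrightarrow> y \<preceq> x \<Longrightarrow> x = y"
  shows "finite R"
proof -
  obtain w where wR: "w \<in> R" and top: "\<And>x. x \<in> R \<Longrightarrow> x \<preceq> w" using greatest_exists by blast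
  have absorb: "w \<oplus> x = w" if "x \<in> R" for x
    using that wR by (intro antisym top) (auto simp: le_def)
  have le0: "x = \<zero>" if "x \<in> R" "x \<preceq> \<zero>" for x
    using that by (intro antisym zero_le) auto
  \<comment> \<open>In the second Bourne case the element \<open>w\<close> itself satisfies
    \<open>w \<oplus> i \<in> I\<close> for some \<open>i \<in> I\<close>, and \<open>w\<close>
    absorbs \<open>i\<close>.\<close>
  have ideal_top: "w \<in> I" if I: "closed_ideal I" and x: "x \<in> I" "x \<noteq> \<zero>" for I x
  proof -
    have "I \<subseteq> R" using I closedin_subset unfolding closed_ideal_def by blast
    from I show ?thesis
    proof (cases rule: closed_ideal_cases)
      case 1
      then show ?thesis using x by blast
    next
      case 2
      then obtain i where "i \<in> I" "w \<oplus> i \<in> I" using wR by blast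
      then show ?thesis using absorb \<open>I \<subseteq> R\<close> by (metis subsetD)
    qed
  qed
  have ww: "x \<odot> y \<preceq> w \<odot> w" if "x \<in> R" "y \<in> R" for x y
  proof (rule le_trans)
    show "x \<odot> y \<preceq> w \<odot> y" "w \<odot> y \<preceq> w \<odot> w" "x \<odot> y \<in> R"
      using that wR by (simp_all add: le_mul_right le_mul_left top)
  qed
  \<comment> \<open>Every product lies below \<open>w \<odot> w\<close>, so multiplication cannot
    leave this set; sums cannot either, because \<open>w \<oplus> w = w\<close> makes
    \<open>w \<odot> w\<close> additively idempotent.\<close>
  have down_ideal: "closed_ideal {x \<in> R. x \<preceq> w \<odot> w}"
    unfolding closed_ideal_def
  proof (intro conjI ballI)
    show "closedin T {x \<in> R. x \<preceq> w \<odot> w}"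
      using wR by (intro closedin_le_maps) simp_all
    show "\<zero> \<in> {x \<in> R. x \<preceq> w \<odot> w}" using wR by (simp add: zero_le)
    fix x assume x: "x \<in> {x \<in> R. x \<preceq> w \<odot> w}"
    show "x \<oplus> y \<in> {x \<in> R. x \<preceq> w \<odot> w}" if y: "y \<in> {x \<in> R. x \<preceq> w \<odot> w}" for y
    proof -
      have "x \<oplus> y \<preceq> w \<odot> w \<oplus> w \<odot> w" using x y by (auto intro: le_add_mono)
      also have "w \<odot> w \<oplus> w \<odot> w = w \<odot> w"
        using distrib_left[of w w w] absorb wR by simp
      finally show ?thesis using x y by simp
    qed
    show "a \<odot> x \<in> {x \<in> R. x \<preceq> w \<odot> w}" "x \<odot> a \<in> {x \<in> R. x \<preceq> w \<odot> w}" if "a \<in> R" for a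
      using x that ww by auto
  qed
  show ?thesis
  proof (cases "w \<odot> w = \<zero>")
    case True
    then have mul0: "x \<odot> y = \<zero>" if "x \<in> R" "y \<in> R" for x y
      using ww[OF that] le0 that by simp
    have "x = w" if x: "x \<in> R" "x \<noteq> \<zero>" for x
    proof -
      let ?J = "{y \<in> R. x \<preceq> y}"
      have clJ: "closedin T ?J"
        using x by (intro closedin_le_maps) simp_all
      let ?TT = "prod_topology T T"
      \<comment> \<open>Collapsing the up-set of \<open>x\<close> is a congruence here, since
        up-sets are stable under addition and all products vanish. It identifies \<open>x\<close>
        with \<open>w\<close>, but not with \<zero>.\<close>
      define E where "E = ?J \<times> ?J \<union> {p \<in> topspace ?TT. fst p = snd p}"
      have "closedin ?TT {p \<in> topspace ?TT. fst p = snd p}"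
        by (rule closedin_equaliser; (rule cont_intros)+)
      then have "closedin ?TT E"
        unfolding E_def using clJ by (intro closedin_Un) (simp_all add: closedin_prod_Times_iff)
      then have "closed_congruence E"
      proof (rule closed_congruenceI)
        show "(c \<oplus> u, c \<oplus> v) \<in> E" if "(u, v) \<in> E" "c \<in> R" for u v c
        proof -
          have "x \<preceq> c \<oplus> t" if "x \<preceq> t" "t \<in> R" for t
          proof -
            have "t \<preceq> c \<oplus> t" unfolding le_def using that \<open>c \<in> R\<close> add_commute by blast
            then show ?thesis using le_trans that x by blast
          qed
          then show ?thesis using that unfolding E_def by auto
        qed
      qed (auto simp: E_def mul0)
      then consider "E \<subseteq> Id" | "E = R \<times> R" using simple by blast
      then show "x = w"
      proof cases
        case 1
        have "(x, w) \<in> E" unfolding E_def using x wR le_refl top by simp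
        then show ?thesis using 1 by blast
      next
        case 2
        then have "(\<zero>, x) \<in> E" using x by simp
        then have "x \<preceq> \<zero>" using x unfolding E_def by auto
        then show ?thesis using le0 x by blast
      qed
    qed
    then have "R \<subseteq> {\<zero>, w}" by blast
    then show ?thesis using finite_subset by blast
  next
    case False
    then have "w \<in> {x \<in> R. x \<preceq> w \<odot> w}"
      using ideal_top[OF down_ideal, of "w \<odot> w"] wR le_refl by simp
    then have idem: "w \<odot> w = w" using antisym top wR by blast
    have full: "w \<odot> x \<odot> w = w" if x: "x \<in> R" "x \<noteq> \<zero>" for x
    proof -
      \<comment> \<open>The elements whose compression by \<open>w\<close> lies below that of
        \<open>x\<close> form an ideal, because \<open>w \<odot> a\<close> and
        \<open>a \<odot> w\<close> lie below \<open>w\<close>. It contains \<open>x\<close>, hence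
        also \<open>w\<close>, whose compression is \<open>w\<close>.\<close>
      let ?J = "{y \<in> R. w \<odot> y \<odot> w \<preceq> w \<odot> x \<odot> w}"
      have "closed_ideal ?J"
        unfolding closed_ideal_def
      proof (intro conjI ballI)
        show "closedin T ?J"
          using x wR by (intro closedin_le_maps continuous_map_mul) simp_all
        show "\<zero> \<in> ?J" using x wR by (simp add: zero_le)
        fix y assume y: "y \<in> ?J"
        show "y \<oplus> v \<in> ?J" if v: "v \<in> ?J" for v
        proof -
          have "w \<odot> (y \<oplus> v) \<odot> w = w \<odot> y \<odot> w \<oplus> w \<odot> v \<odot> w"
            using y v wR by (simp add: distrib_left distrib_right)
          also have "\<dots> \<preceq> w \<odot> x \<odot> w \<oplus> w \<odot> x \<odot> w"
            using y v wR by (intro le_add_mono) auto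
          also have "w \<odot> x \<odot> w \<oplus> w \<odot> x \<odot> w = w \<odot> x \<odot> w"
            using distrib_left[of "w \<odot> x" w w] absorb wR x by simp
          finally show ?thesis using y v by simp
        qed
        have y': "y \<in> R" "w \<odot> y \<odot> w \<preceq> w \<odot> x \<odot> w" using y by simp_all
        fix a assume a: "a \<in> R"
        have "w \<odot> a \<odot> (y \<odot> w) \<preceq> w \<odot> (y \<odot> w)"
          using y' a wR by (intro le_mul_right top) auto
        then have "w \<odot> (a \<odot> y) \<odot> w \<preceq> w \<odot> x \<odot> w"
          using y' a wR x le_trans[of "w \<odot> (a \<odot> y) \<odot> w" "w \<odot> y \<odot> w"] by (simp add: mul_assoc)
        then show "a \<odot> y \<in> ?J" using y a by simp
        have "(w \<odot> y) \<odot> (a \<odot> w) \<preceq> (w \<odot> y) \<odot> w"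
          using y' a wR by (intro le_mul_left top) auto
        then have "w \<odot> (y \<odot> a) \<odot> w \<preceq> w \<odot> x \<odot> w"
          using y' a wR x le_trans[of "w \<odot> (y \<odot> a) \<odot> w" "w \<odot> y \<odot> w"] by (simp add: mul_assoc)
        then show "y \<odot> a \<in> ?J" using y a by simp
      qed
      then have "w \<in> ?J" using ideal_top[of ?J x] x wR le_refl by simp
      then have "w \<preceq> w \<odot> x \<odot> w" using idem by simp
      then show ?thesis using antisym top wR x by simp
    qed
    show ?thesis
    proof (cases "w = \<zero>")
      case True
      then have "R \<subseteq> {\<zero>}" using le0 top by blast
      then show ?thesis using finite_subset by blast
    next
      case False
      \<comment> \<open>This closed condition holds exactly at the nonzero elements, so zero is
        isolated.\<close>
      have "closedin T {x \<in> R. w \<odot> x \<odot> w = w}"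
        using wR by (intro closedin_equaliser continuous_map_mul) simp_all
      moreover have "{x \<in> R. w \<odot> x \<odot> w = w} = R - {\<zero>}"
      proof -
        have "w \<odot> \<zero> \<odot> w \<noteq> w" using wR False by simp
        then show ?thesis using full by blast
      qed
      ultimately have "openin T {\<zero>}"
        by (simp add: closedin_def double_diff)
      moreover have "closedin T {\<zero>}"
        using Hausdorff by (simp add: closedin_Hausdorff_singleton)
      ultimately show ?thesis
        using finite_if_clopen[of "{\<zero>}" \<zero> w] wR False by simp
    qed
  qed
qed

end

section \<open>Compact rings\<close>

context compact_semiring
begin

lemma product_nbhd:
  assumes "continuous_map (prod_topology T T) T (\<lambda>p. f (fst p) (snd p))" "openin T U"
    and "a \<in> R" "b \<in> R" "f a b \<in> U"
  obtains V W where "openin T V" "openin T W" "a \<in> V" "b \<in> W"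
    "\<And>x y. x \<in> V \<Longrightarrow> y \<in> W \<Longrightarrow> f x y \<in> U"
proof -
  let ?P = "{p \<in> topspace (prod_topology T T). f (fst p) (snd p) \<in> U}"
  have "openin (prod_topology T T) ?P"
    using assms(1,2) by (rule openin_continuous_map_preimage)
  moreover have "(a, b) \<in> ?P" using assms(3-5) by simp
  ultimately obtain V W where VW: "openin T V" "openin T W" "a \<in> V" "b \<in> W" "V \<times> W \<subseteq> ?P"
    unfolding openin_prod_topology_alt by meson
  have "f x y \<in> U" if "x \<in> V" "y \<in> W" for x y
    using subsetD[OF VW(5), of "(x, y)"] that by simp
  with VW(1-4) show thesis by (rule that)
qed

lemma square_nbhd:
  assumes "continuous_map (prod_topology T T) T (\<lambda>p. f (fst p) (snd p))" "openin T U"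
    and "a \<in> R" "f a a \<in> U"
  obtains V where "openin T V" "a \<in> V" "\<And>x y. x \<in> V \<Longrightarrow> y \<in> V \<Longrightarrow> f x y \<in> U"
proof -
  obtain V W where "openin T V" "openin T W" "a \<in> V" "a \<in> W" "\<And>x y. x \<in> V \<Longrightarrow> y \<in> W \<Longrightarrow> f x y \<in> U"
    using product_nbhd[OF assms(1,2,3,3,4)] by blast
  then show thesis using that[of "V \<inter> W"] by blast
qed

lemma closed_nbhd:
  assumes "openin T U" "x \<in> U"
  obtains V C where "openin T V" "closedin T C" "x \<in> V" "V \<subseteq> C" "C \<subseteq> U"
proof -
  have "regular_space T"
    using compact Hausdorff by (simp add: compact_Hausdorff_imp_regular_space)
  then have "neighbourhood_base_of (closedin T) T"
    by (simp add: neighbourhood_base_of_closedin)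
  then show thesis
    using assms that unfolding neighbourhood_base_of by meson
qed

lemma openin_delete: "openin T (R - {x})"
  using Hausdorff
  by (cases "x \<in> R") (auto simp: closedin_Hausdorff_singleton openin_diff)

lemma closure_of_add:
  assumes "H \<subseteq> R" "\<And>x y. x \<in> H \<Longrightarrow> y \<in> H \<Longrightarrow> x \<oplus> y \<in> H"
    and "x \<in> T closure_of H" "y \<in> T closure_of H"
  shows "x \<oplus> y \<in> T closure_of H"
proof -
  let ?TT = "prod_topology T T"
  have "continuous_map ?TT T (\<lambda>p. fst p \<oplus> snd p)"
    by (rule cont_intros)+
  then have "(\<lambda>p. fst p \<oplus> snd p) ` (?TT closure_of (H \<times> H)) \<subseteq> T closure_of ((\<lambda>p. fst p \<oplus> snd p) ` (H \<times> H))"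
    by (rule continuous_map_image_closure_subset)
  also have "\<dots> \<subseteq> T closure_of H"
    using assms(2) by (intro closure_of_mono) auto
  finally show ?thesis
    using assms(3,4) unfolding closure_of_Times image_subset_iff by force
qed

fun nmul :: "nat \<Rightarrow> 'a \<Rightarrow> 'a" where
  "nmul 0 x = \<zero>"
| "nmul (Suc n) x = x \<oplus> nmul n x"

lemma nmul_closed [simp, intro]: "x \<in> R \<Longrightarrow> nmul n x \<in> R"
  by (induction n) auto

lemma nmul_1 [simp]: "x \<in> R \<Longrightarrow> nmul (Suc 0) x = x"
  by simp

lemma nmul_zero [simp]: "nmul n \<zero> = \<zero>"
  by (induction n) auto

lemma nmul_add: "x \<in> R \<Longrightarrow> nmul (m + n) x = nmul m x \<oplus> nmul n x"
  by (induction m) (auto simp: add_assoc)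

lemma nmul_mult: "x \<in> R \<Longrightarrow> nmul (m * n) x = nmul m (nmul n x)"
  by (induction m) (auto simp: nmul_add)

lemma nmul_distrib: "x \<in> R \<Longrightarrow> y \<in> R \<Longrightarrow> nmul n (x \<oplus> y) = nmul n x \<oplus> nmul n y"
proof (induction n)
  case (Suc n)
  then show ?case by (simp add: add_ac)
qed simp

lemma mul_nmul_right: "x \<in> R \<Longrightarrow> y \<in> R \<Longrightarrow> x \<odot> nmul n y = nmul n (x \<odot> y)"
  by (induction n) (auto simp: distrib_left)

lemma mul_nmul_left: "x \<in> R \<Longrightarrow> y \<in> R \<Longrightarrow> nmul n x \<odot> y = nmul n (x \<odot> y)"
  by (induction n) (auto simp: distrib_right)

lemma continuous_map_nmul: "continuous_map X T f \<Longrightarrow> continuous_map X T (\<lambda>x. nmul n (f x))"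
  by (induction n) (auto intro: continuous_map_add)

lemma nmul_in_submonoid:
  assumes "\<zero> \<in> H" "\<And>x y. x \<in> H \<Longrightarrow> y \<in> H \<Longrightarrow> x \<oplus> y \<in> H" "x \<in> H"
  shows "nmul n x \<in> H"
  using assms by (induction n) auto

end

section \<open>Subtraction, recurrence and ideals in a compact ring\<close>

locale simple_compact_ring = simple_compact_semiring +
  assumes neg_exists: "x \<in> R \<Longrightarrow> \<exists>y\<in>R. x \<oplus> y = \<zero>"
begin

lemma add_left_cancel:
  assumes "x \<in> R" "y \<in> R" "c \<in> R"
  shows "c \<oplus> x = c \<oplus> y \<longleftrightarrow> x = y"
proof
  assume *: "c \<oplus> x = c \<oplus> y"
  obtain d where d: "d \<in> R" "c \<oplus> d = \<zero>" using neg_exists assms by blast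
  then have "d \<oplus> c = \<zero>" using add_commute assms by metis
  then have "x = d \<oplus> (c \<oplus> x)" "y = d \<oplus> (c \<oplus> y)"
    using assms d by (simp_all flip: add_assoc)
  then show "x = y" using * by simp
qed simp

definition diff :: "'a \<Rightarrow> 'a \<Rightarrow> 'a" (infixl "\<ominus>" 65) where
  "x \<ominus> y = (THE w. w \<in> R \<and> y \<oplus> w = x)"

lemma diff_unique:
  assumes "w \<in> R" "y \<in> R" "y \<oplus> w = x"
  shows "x \<ominus> y = w"
  unfolding diff_def using assms by (intro the_equality) (auto simp: add_left_cancel)

lemma
  assumes "x \<in> R" "y \<in> R"
  shows diff_closed [simp, intro]: "x \<ominus> y \<in> R" and add_diff: "y \<oplus> (x \<ominus> y) = x"
proof -
  obtain d where d: "d \<in> R" "y \<oplus> d = \<zero>" using neg_exists assms by blast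
  have "y \<oplus> (d \<oplus> x) = x" using d assms by (simp flip: add_assoc)
  then have "x \<ominus> y = d \<oplus> x" using assms d by (intro diff_unique) auto
  then show "x \<ominus> y \<in> R" "y \<oplus> (x \<ominus> y) = x"
    using \<open>y \<oplus> (d \<oplus> x) = x\<close> d assms by auto
qed

lemma diff_self [simp]: "x \<in> R \<Longrightarrow> x \<ominus> x = \<zero>"
  by (intro diff_unique) auto

lemma diff_zero [simp]: "x \<in> R \<Longrightarrow> x \<ominus> \<zero> = x"
  by (intro diff_unique) auto

text \<open>Continuity of subtraction is not assumed. The shear \<open>(x, y)\<close> to
  \<open>(x, x \<oplus> y)\<close> is a continuous bijection of a compact Hausdorff space, so its
  inverse is continuous, and the second coordinate of that inverse is subtraction.\<close>

lemma continuous_map_diff: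
  assumes f: "continuous_map X T f" and g: "continuous_map X T g"
  shows "continuous_map X T (\<lambda>x. f x \<ominus> g x)"
proof -
  let ?TT = "prod_topology T T" and ?h = "\<lambda>p. (fst p, fst p \<oplus> snd p)"
  have "continuous_map ?TT ?TT ?h"
    by (rule cont_intros)+
  moreover have "?h ` topspace ?TT = topspace ?TT"
  proof (intro equalityI subsetI)
    fix p assume "p \<in> topspace ?TT"
    then obtain x y where p: "p = (x, y)" "x \<in> R" "y \<in> R" by auto
    show "p \<in> ?h ` topspace ?TT"
      by (rule image_eqI[of _ _ "(x, y \<ominus> x)"]) (use p in \<open>simp_all add: add_diff\<close>)
  qed auto
  moreover have "inj_on ?h (topspace ?TT)"
    by (auto simp: inj_on_def add_left_cancel)
  ultimately have "homeomorphic_map ?TT ?TT ?h"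
    using compact Hausdorff
    by (intro continuous_imp_homeomorphic_map)
       (simp_all add: compact_space_prod_topology Hausdorff_space_prod_topology)
  then obtain k where k: "homeomorphic_maps ?TT ?TT ?h k"
    using homeomorphic_map_maps by blast
  have "continuous_map ?TT ?TT k" using k unfolding homeomorphic_maps_def by simp
  moreover have "continuous_map X ?TT (\<lambda>x. (g x, f x))"
    using f g by (rule continuous_map_pairedI[rotated])
  ultimately have "continuous_map X ?TT (\<lambda>x. k (g x, f x))"
    using continuous_map_compose[of X ?TT "\<lambda>x. (g x, f x)" ?TT k] by (simp add: o_def)
  then have "continuous_map X T (\<lambda>x. snd (k (g x, f x)))"
    by (rule continuous_map_snd_comp)
  moreover have "snd (k (g x, f x)) = f x \<ominus> g x" if "x \<in> topspace X" for x
  proof -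
    have R: "f x \<in> R" "g x \<in> R" using that f g unfolding continuous_map_def by auto
    then have "(g x, f x) = ?h (g x, f x \<ominus> g x)" by (simp add: add_diff)
    moreover have "k (?h (g x, f x \<ominus> g x)) = (g x, f x \<ominus> g x)"
      using k R unfolding homeomorphic_maps_def by auto
    ultimately show ?thesis by simp
  qed
  ultimately show ?thesis by (rule continuous_map_eq)
qed

lemma openin_translate:
  assumes "openin T U" "c \<in> R"
  shows "openin T {y \<in> R. y \<ominus> c \<in> U}"
  using assms by (intro openin_continuous_map_preimage[OF continuous_map_diff]) simp_all

lemma diff_nbhd:
  assumes "openin T U" "\<zero> \<in> U"
  obtains V where "openin T V" "\<zero> \<in> V" "\<And>x y. x \<in> V \<Longrightarrow> y \<in> V \<Longrightarrow> x \<ominus> y \<in> U"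
proof -
  have "continuous_map (prod_topology T T) T (\<lambda>p. fst p \<ominus> snd p)"
    by (rule continuous_map_diff; (rule cont_intros)+)
  then show thesis using square_nbhd[of "(\<ominus>)" U \<zero>] assms that by auto
qed

lemma nmul_diff:
  assumes "x \<in> R" "y \<in> R"
  shows "nmul n (x \<ominus> y) = nmul n x \<ominus> nmul n y"
proof (rule diff_unique[symmetric])
  show "nmul n y \<oplus> nmul n (x \<ominus> y) = nmul n x"
    using assms by (simp add: nmul_distrib[symmetric] add_diff)
qed (use assms in auto)

text \<open>Pigeonhole: finitely many translates of a small neighbourhood cover \<open>R\<close>,
  two multiples of \<open>x\<close> fall into the same one, and their difference is a multiple close
  to zero.\<close>

lemma recurrence:
  assumes x: "x \<in> R" and U: "openin T U" "\<zero> \<in> U"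
  obtains n where "n > 0" "nmul n x \<in> U"
proof -
  obtain V where V: "openin T V" "\<zero> \<in> V" "\<And>x y. x \<in> V \<Longrightarrow> y \<in> V \<Longrightarrow> x \<ominus> y \<in> U"
    using diff_nbhd U by blast
  let ?N = "\<lambda>c. {y \<in> R. y \<ominus> c \<in> V}"
  have "R \<subseteq> \<Union>(?N ` R)" using V(2) by auto
  moreover have "\<And>B. B \<in> ?N ` R \<Longrightarrow> openin T B"
    using openin_translate V(1) by blast
  ultimately obtain \<F> where \<F>: "finite \<F>" "\<F> \<subseteq> ?N ` R" "R \<subseteq> \<Union>\<F>"
    using compact unfolding compact_space_alt by meson
  have "\<forall>j. \<exists>B. B \<in> \<F> \<and> nmul j x \<in> B" using \<F>(3) x by blast
  then obtain B where B: "\<And>j. B j \<in> \<F> \<and> nmul j x \<in> B j" by metis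
  have "\<not> inj B"
    using \<F>(1) B finite_subset[of "range B" \<F>] finite_imageD[of B UNIV] by auto
  then obtain i j where "i < j" "B i = B j"
    unfolding inj_def by (metis nat_neq_iff)
  moreover obtain c where c: "c \<in> R" "B i = ?N c" using B \<F>(2) by blast
  ultimately have "nmul i x \<ominus> c \<in> V" "nmul j x \<ominus> c \<in> V"
    using B[of i] B[of j] by auto
  then have "(nmul j x \<ominus> c) \<ominus> (nmul i x \<ominus> c) \<in> U" using V(3) by blast
  moreover have "(nmul j x \<ominus> c) \<ominus> (nmul i x \<ominus> c) = nmul (j - i) x"
  proof (intro diff_unique)
    have "c \<oplus> (nmul i x \<ominus> c \<oplus> nmul (j - i) x) = nmul i x \<oplus> nmul (j - i) x"
      using x c by (simp add: add_diff flip: add_assoc)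
    also have "\<dots> = nmul j x"
      using nmul_add[of x i "j - i"] x \<open>i < j\<close> by simp
    finally have "nmul j x \<ominus> c = nmul i x \<ominus> c \<oplus> nmul (j - i) x"
      using x c by (intro diff_unique) auto
    then show "nmul i x \<ominus> c \<oplus> nmul (j - i) x = nmul j x \<ominus> c" by simp
  qed (use x c in auto)
  ultimately show thesis using that[of "j - i"] \<open>i < j\<close> by simp
qed

text \<open>Subtractivity says that \<open>I\<close> contains everything Bourne-congruent to
  zero.\<close>

lemma subtractive_ideal_trivial:
  assumes I: "closed_ideal I" and sub: "\<And>x i. x \<in> R \<Longrightarrow> i \<in> I \<Longrightarrow> x \<oplus> i \<in> I \<Longrightarrow> x \<in> I"
  shows "I = {\<zero>} \<or> I = R"
  using I
proof (cases rule: closed_ideal_cases)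
  case 2
  then have "R \<subseteq> I" using sub by blast
  moreover have "I \<subseteq> R" using I closedin_subset unfolding closed_ideal_def by blast
  ultimately show ?thesis by blast
qed simp

text \<open>Kernel and image of \<open>nmul n\<close> are closed ideals, the image by compactness,
  so each is zero or everything. A zero image is the first alternative, and it is forced by a full
  kernel.\<close>

lemma torsion_dichotomy:
  assumes "n > 0"
  shows "(\<forall>x\<in>R. nmul n x = \<zero>) \<or>
    (\<forall>x\<in>R. nmul n x = \<zero> \<longrightarrow> x = \<zero>) \<and> nmul n ` R = R"
proof -
  have "closed_ideal {x \<in> R. nmul n x = \<zero>}"
    unfolding closed_ideal_def
  proof (intro conjI ballI)
    show "closedin T {x \<in> R. nmul n x = \<zero>}"
      by (intro closedin_equaliser continuous_map_nmul) simp_all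
    fix x a assume "x \<in> {x \<in> R. nmul n x = \<zero>}" "a \<in> R"
    then show "a \<odot> x \<in> {x \<in> R. nmul n x = \<zero>}" "x \<odot> a \<in> {x \<in> R. nmul n x = \<zero>}"
      using mul_nmul_right[of a x n] mul_nmul_left[of x a n] by auto
  qed (auto simp: nmul_distrib)
  then have 1: "{x \<in> R. nmul n x = \<zero>} = {\<zero>} \<or> {x \<in> R. nmul n x = \<zero>} = R"
    by (rule subtractive_ideal_trivial) (auto simp: nmul_distrib)
  have "closed_ideal (nmul n ` R)"
    unfolding closed_ideal_def
  proof (intro conjI ballI)
    show "closedin T (nmul n ` R)"
      by (intro closedin_image continuous_map_nmul) simp_all
    show "\<zero> \<in> nmul n ` R" by (rule image_eqI[of _ _ \<zero>]) auto
    fix x assume "x \<in> nmul n ` R"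
    then obtain a where a: "a \<in> R" "x = nmul n a" by blast
    show "x \<oplus> y \<in> nmul n ` R" if y: "y \<in> nmul n ` R" for y
    proof -
      obtain b where "b \<in> R" "y = nmul n b" using y by blast
      then show ?thesis
        using a by (intro image_eqI[of _ _ "a \<oplus> b"]) (simp_all add: nmul_distrib)
    qed
    fix b assume b: "b \<in> R"
    show "b \<odot> x \<in> nmul n ` R"
      using a b by (intro image_eqI[of _ _ "b \<odot> a"]) (simp_all add: mul_nmul_right)
    show "x \<odot> b \<in> nmul n ` R"
      using a b by (intro image_eqI[of _ _ "a \<odot> b"]) (simp_all add: mul_nmul_left)
  qed
  then have 2: "nmul n ` R = {\<zero>} \<or> nmul n ` R = R"
  proof (rule subtractive_ideal_trivial)
    fix x i assume x: "x \<in> R" and "i \<in> nmul n ` R" "x \<oplus> i \<in> nmul n ` R"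
    then obtain a b where ab: "a \<in> R" "b \<in> R" "i = nmul n a" "x \<oplus> i = nmul n b" by blast
    then have "nmul n a \<oplus> x = nmul n b" using x add_commute by auto
    then have "nmul n (b \<ominus> a) = x"
      using ab x by (simp add: nmul_diff diff_unique)
    then show "x \<in> nmul n ` R" using ab by blast
  qed
  show ?thesis
  proof (cases "nmul n ` R = {\<zero>}")
    case True
    then show ?thesis by blast
  next
    case False
    then have "nmul n ` R = R" using 2 by blast
    moreover have "\<forall>x\<in>R. nmul n x = \<zero> \<longrightarrow> x = \<zero>"
    proof (cases "{x \<in> R. nmul n x = \<zero>} = {\<zero>}")
      case True
      then show ?thesis by blast
    next
      case not: False
      then have "\<forall>x\<in>R. nmul n x = \<zero>" using 1 by blast
      then have "nmul n ` R = {\<zero>}" using zero_closed by (auto simp: image_iff)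
      then show ?thesis using False by blast
    qed
    ultimately show ?thesis by blast
  qed
qed

end

section \<open>Bogolyubov's lemma\<close>

text \<open>The standard character \<open>exp(2 pi i t / n)\<close> of \<open>Z/n\<close>, taken on
  integers so that signed combinations of coordinates need no reduction modulo
  \<open>n\<close>.\<close>

definition unit_char :: "nat \<Rightarrow> int \<Rightarrow> complex" where
  "unit_char n t = cis (2 * pi * of_int t / of_nat n)"

lemma unit_char_add: "unit_char n (s + t) = unit_char n s * unit_char n t"
  unfolding unit_char_def cis_mult by (simp add: distrib_left add_divide_distrib)

lemma unit_char_0 [simp]: "unit_char n 0 = 1"
  unfolding unit_char_def by simp

lemma cnj_unit_char: "cnj (unit_char n t) = unit_char n (- t)"
  unfolding unit_char_def cis_cnj by simp

lemma norm_unit_char [simp]: "norm (unit_char n t) = 1"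
  unfolding unit_char_def by simp

lemma unit_char_sum: "unit_char n (sum f A) = (\<Prod>x\<in>A. unit_char n (f x))"
  by (induction A rule: infinite_finite_induct) (simp_all add: unit_char_add)

lemma unit_char_mult_nat: "unit_char n (int j * t) = unit_char n t ^ j"
  by (induction j) (simp_all add: distrib_right unit_char_add)

lemma unit_char_eq_1_iff:
  assumes "n > 0"
  shows "unit_char n t = 1 \<longleftrightarrow> int n dvd t"
proof -
  have "unit_char n t = 1 \<longleftrightarrow> (\<exists>k::int. 2 * pi * of_int t / of_nat n = of_int (2 * k) * pi)"
    unfolding unit_char_def cis_conv_exp exp_eq_1 by simp
  also have "\<dots> \<longleftrightarrow> (\<exists>k::int. t = int n * k)"
  proof -
    have "2 * pi * of_int t / of_nat n = of_int (2 * k) * pi \<longleftrightarrow> t = int n * k" for k :: int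
    proof -
      have "2 * pi * of_int t / of_nat n = of_int (2 * k) * pi \<longleftrightarrow> (of_int t :: real) = of_nat n * of_int k"
        using assms by (simp add: field_simps)
      also have "\<dots> \<longleftrightarrow> (of_int t :: real) = of_int (int n * k)" by simp
      also have "\<dots> \<longleftrightarrow> t = int n * k" by (rule of_int_eq_iff)
      finally show ?thesis .
    qed
    then show ?thesis by simp
  qed
  finally show ?thesis by (simp add: dvd_def)
qed

lemma sum_unit_char:
  assumes "n > 0"
  shows "(\<Sum>j<n. unit_char n (int j * t)) = (if int n dvd t then of_nat n else 0)"
proof (cases "int n dvd t")
  case True
  then have "unit_char n t = 1" using assms by (simp add: unit_char_eq_1_iff)
  then show ?thesis using True by (simp add: unit_char_mult_nat)
next
  case False
  then have ne: "unit_char n t \<noteq> 1" using assms by (simp add: unit_char_eq_1_iff)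
  have "unit_char n t ^ n = 1"
    using assms by (simp flip: unit_char_mult_nat add: unit_char_eq_1_iff)
  then show ?thesis using False ne by (simp add: unit_char_mult_nat geometric_sum)
qed

text \<open>Orthogonality of characters. The set \<open>F \<rightarrow>\<^sub>E {..<n}\<close> of
  reduced vectors plays both \<open>(Z/n)^F\<close> and its dual group; the sum over the dual
  factors over the coordinates.\<close>

lemma sum_unit_char_PiE:
  assumes "n > 0" "finite F"
  shows "(\<Sum>s\<in>F \<rightarrow>\<^sub>E {..<n}. unit_char n (\<Sum>g\<in>F. int (s g) * t g)) =
    (if \<forall>g\<in>F. int n dvd t g then of_nat n ^ card F else 0)"
proof -
  have "(\<Sum>s\<in>F \<rightarrow>\<^sub>E {..<n}. unit_char n (\<Sum>g\<in>F. int (s g) * t g)) =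
      (\<Prod>g\<in>F. \<Sum>j<n. unit_char n (int j * t g))"
    using assms by (simp add: unit_char_sum prod_sum_PiE)
  also have "\<dots> = (\<Prod>g\<in>F. if int n dvd t g then of_nat n else 0)"
    using assms by (simp add: sum_unit_char)
  also have "\<dots> = (if \<forall>g\<in>F. int n dvd t g then of_nat n ^ card F else 0)"
    using assms(2) by (auto intro: prod_zero)
  finally show ?thesis .
qed

lemma PiE_eqI_mod:
  assumes "a \<in> F \<rightarrow>\<^sub>E {..<n}" "b \<in> F \<rightarrow>\<^sub>E {..<n}" "\<And>g. g \<in> F \<Longrightarrow> int n dvd int (a g) - int (b g)"
  shows "a = b"
proof (rule PiE_ext[OF assms(1,2)])
  fix g assume g: "g \<in> F"
  have "int (a g) mod int n = int (b g) mod int n"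
    using assms(3)[OF g] by (simp add: mod_eq_dvd_iff)
  moreover have "a g < n" "b g < n" using assms g by auto
  ultimately show "a g = b g" by simp
qed

text \<open>\<open>S\<close> is the large spectrum of \<open>A\<close>. By Parseval, the fourth moment of the Fourier transform of
  \<open>A\<close> twisted by a point \<open>v\<close> orthogonal to \<open>S\<close> is dominated by the trivial character and cannot vanish,
  and this moment counts the representations of \<open>v\<close> by \<open>A\<close>.\<close>

lemma bogolyubov:
  fixes F :: "'g set" and n k :: nat and A :: "('g \<Rightarrow> nat) set"
  assumes n: "n > 0" and F: "finite F" and AX: "A \<subseteq> F \<rightarrow>\<^sub>E {..<n}"
    and dense: "card (F \<rightarrow>\<^sub>E {..<n}) \<le> k * card A"
  obtains S where "S \<subseteq> F \<rightarrow>\<^sub>E {..<n}" "S \<noteq> {}" "card S \<le> k ^ 2"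
    "\<forall>v :: 'g \<Rightarrow> nat. (\<forall>s\<in>S. n dvd (\<Sum>g\<in>F. s g * v g)) \<longrightarrow>
       (\<exists>a\<in>A. \<exists>b\<in>A. \<exists>c\<in>A. \<exists>d\<in>A. \<forall>g\<in>F. int n dvd int (v g) + int (a g) + int (c g) - int (b g) - int (d g))"
proof -
  define X where "X = F \<rightarrow>\<^sub>E {..<n}"
  define N where "N = card X"
  have finX: "finite X" unfolding X_def using F by (simp add: finite_PiE)
  have AX': "A \<subseteq> X" using AX unfolding X_def .
  have finA: "finite A" using AX' finX by (rule finite_subset)
  have N: "N = n ^ card F" unfolding N_def X_def using F by (simp add: card_PiE)
  have Npos: "N > 0" unfolding N using n by simp
  have Apos: "card A > 0" using dense Npos unfolding N_def X_def by (cases "card A = 0") auto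
  define e where "e = unit_char n"
  define dot where "dot = (\<lambda>(s :: 'g \<Rightarrow> nat) (t :: 'g \<Rightarrow> int). \<Sum>g\<in>F. int (s g) * t g)"
  have dot_add: "dot s (\<lambda>g. t g + u g) = dot s t + dot s u" for s t u
    unfolding dot_def by (simp add: distrib_left sum.distrib)
  have dot_minus: "dot s (\<lambda>g. - t g) = - dot s t" for s t
    unfolding dot_def by (simp add: sum_negf)
  have orth: "(\<Sum>s\<in>X. e (dot s t)) = (if \<forall>g\<in>F. int n dvd t g then of_nat N else 0)" for t
    unfolding X_def e_def dot_def N using sum_unit_char_PiE[OF n F] by simp
  \<comment> \<open>The unnormalised Fourier transform of the indicator function of
    \<open>A\<close>.\<close>
  define fA where "fA = (\<lambda>s. \<Sum>a\<in>A. e (dot s (\<lambda>g. int (a g))))"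
  have cnj_fA: "cnj (fA s) = (\<Sum>a\<in>A. e (dot s (\<lambda>g. - int (a g))))" for s
    unfolding fA_def e_def by (simp add: cnj_unit_char dot_minus)
  define m where "m = (\<lambda>s. (cmod (fA s))\<^sup>2)"
  have m_nonneg: "m s \<ge> 0" for s unfolding m_def by simp
  have m_sum: "complex_of_real (m s) = (\<Sum>(a, b)\<in>A \<times> A. e (dot s (\<lambda>g. int (a g) - int (b g))))" for s
  proof -
    have "complex_of_real (m s) = fA s * cnj (fA s)"
      unfolding m_def by (rule complex_norm_square)
    also have "\<dots> = (\<Sum>(a, b)\<in>A \<times> A. e (dot s (\<lambda>g. int (a g))) * e (dot s (\<lambda>g. - int (b g))))"
      unfolding cnj_fA unfolding fA_def by (simp add: sum_product sum.cartesian_product)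
    also have "\<dots> = (\<Sum>(a, b)\<in>A \<times> A. e (dot s (\<lambda>g. int (a g) - int (b g))))"
      unfolding e_def unit_char_add[symmetric] dot_add[symmetric] by simp
    finally show ?thesis .
  qed
  have parseval: "(\<Sum>s\<in>X. m s) = real N * real (card A)"
  proof -
    have "complex_of_real (\<Sum>s\<in>X. m s) = (\<Sum>s\<in>X. \<Sum>(a, b)\<in>A \<times> A. e (dot s (\<lambda>g. int (a g) - int (b g))))"
      by (simp add: m_sum)
    also have "\<dots> = (\<Sum>(a, b)\<in>A \<times> A. \<Sum>s\<in>X. e (dot s (\<lambda>g. int (a g) - int (b g))))"
      unfolding case_prod_unfold by (rule sum.swap)
    also have "\<dots> = (\<Sum>(a, b)\<in>A \<times> A. if a = b then of_nat N else 0)"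
    proof (rule sum.cong[OF refl], clarify)
      fix a b assume ab: "a \<in> A" "b \<in> A"
      have "(\<forall>g\<in>F. int n dvd int (a g) - int (b g)) \<longleftrightarrow> a = b"
        using PiE_eqI_mod[of a F n b] ab AX by auto
      then show "(\<Sum>s\<in>X. e (dot s (\<lambda>g. int (a g) - int (b g)))) = (if a = b then of_nat N else 0)"
        unfolding orth by simp
    qed
    also have "\<dots> = (\<Sum>a\<in>A. \<Sum>b\<in>A. if a = b then of_nat N else 0)"
      by (simp add: sum.cartesian_product)
    also have "\<dots> = complex_of_real (real N * real (card A))"
      using finA by simp
    finally show ?thesis unfolding of_real_eq_iff .
  qed
  \<comment> \<open>The threshold is tuned so that \<open>\<tau> * N * card A\<close> equals
    \<open>(card A)^4\<close>, the weight of the trivial character in the fourth moment. By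
    Parseval, at most \<open>(N / card A)^2\<close>, hence at most \<open>k^2\<close>, characters
    can reach it.\<close>
  define \<tau> where "\<tau> = real (card A) ^ 3 / real N"
  have \<tau>pos: "\<tau> > 0" unfolding \<tau>_def using Apos Npos by simp
  define S where "S = {s \<in> X. m s \<ge> \<tau>}"
  \<comment> \<open>The trivial character, at which the transform takes the value
    \<open>card A\<close>.\<close>
  define o0 where "o0 = (\<lambda>g\<in>F. 0 :: nat)"
  have o0X: "o0 \<in> X" unfolding o0_def X_def using n by auto
  have "dot o0 t = 0" for t unfolding dot_def o0_def by simp
  then have m0: "m o0 = (real (card A))\<^sup>2" unfolding m_def fA_def e_def by simp
  have AN: "card A \<le> N" unfolding N_def using AX' finX by (simp add: card_mono)
  have "o0 \<in> S"
  proof -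
    have "real (card A) ^ 3 \<le> (real (card A))\<^sup>2 * real N"
      using AN by (simp add: power3_eq_cube power2_eq_square mult_left_mono)
    then show ?thesis unfolding S_def m0 \<tau>_def using o0X Npos by (simp add: m0 pos_divide_le_eq)
  qed
  have SX: "S \<subseteq> X" unfolding S_def by auto
  have finS: "finite S" using SX finX by (rule finite_subset)
  have cardS: "card S \<le> k ^ 2"
  proof -
    have "real (card S) * \<tau> = (\<Sum>s\<in>S. \<tau>)" by simp
    also have "\<dots> \<le> (\<Sum>s\<in>S. m s)" by (rule sum_mono) (simp add: S_def)
    also have "\<dots> \<le> (\<Sum>s\<in>X. m s)" using SX finX m_nonneg by (intro sum_mono2) auto
    also have "\<dots> = real N * real (card A)" by (rule parseval)
    finally have "real (card S) * real (card A) ^ 3 \<le> real N * real (card A) * real N"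
      unfolding \<tau>_def using Npos by (simp add: field_simps)
    then have "(real (card S) * (real (card A))\<^sup>2) * real (card A) \<le> (real N)\<^sup>2 * real (card A)"
      by (simp add: power3_eq_cube power2_eq_square mult_ac)
    then have "real (card S) * (real (card A))\<^sup>2 \<le> (real N)\<^sup>2"
      using Apos by simp
    also have "\<dots> \<le> (real k * real (card A))\<^sup>2"
      using dense unfolding N_def X_def by (intro power_mono) (simp_all flip: of_nat_mult)
    also have "\<dots> = (real k)\<^sup>2 * (real (card A))\<^sup>2" by (simp add: power_mult_distrib)
    finally have "real (card S) \<le> (real k)\<^sup>2" using Apos by simp
    then show ?thesis by (simp flip: of_nat_power)
  qed
  have main: "\<exists>a\<in>A. \<exists>b\<in>A. \<exists>c\<in>A. \<exists>d\<in>A. \<forall>g\<in>F. int n dvd int (v g) + int (a g) + int (c g) - int (b g) - int (d g)"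
    if v: "\<And>s. s \<in> S \<Longrightarrow> n dvd (\<Sum>g\<in>F. s g * v g)" for v :: "'g \<Rightarrow> nat"
  proof (rule ccontr)
    assume contra: "\<not> ?thesis"
    let ?v = "\<lambda>g. int (v g)"
    let ?w = "\<lambda>a b c d g. (int (a g) - int (b g)) + (int (c g) - int (d g)) + int (v g)"
    \<comment> \<open>By orthogonality \<open>Z\<close> is \<open>N\<close> times the number of
      quadruples from \<open>A\<close> that solve the congruence for \<open>v\<close>, so
      \<open>contra\<close> makes it vanish.\<close>
    define Z where "Z = (\<Sum>s\<in>X. complex_of_real ((m s)\<^sup>2) * e (dot s ?v))"
    have "Z = (\<Sum>s\<in>X. \<Sum>((a, b), (c, d))\<in>(A \<times> A) \<times> (A \<times> A). e (dot s (?w a b c d)))"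
      unfolding Z_def
    proof (rule sum.cong[OF refl])
      fix s
      have "complex_of_real ((m s)\<^sup>2) * e (dot s ?v) = complex_of_real (m s) * complex_of_real (m s) * e (dot s ?v)"
        by (simp add: power2_eq_square)
      also have "\<dots> = (\<Sum>(p, q)\<in>(A \<times> A) \<times> (A \<times> A). e (dot s (\<lambda>g. int (fst p g) - int (snd p g))) *
          e (dot s (\<lambda>g. int (fst q g) - int (snd q g))) * e (dot s ?v))"
      proof -
        have *: "sum f B * sum f B * c = (\<Sum>(p, q)\<in>B \<times> B. f p * f q * c)"
          for f :: "('g \<Rightarrow> nat) \<times> ('g \<Rightarrow> nat) \<Rightarrow> complex" and B c
        proof -
          have "sum f B * sum f B = (\<Sum>(p, q)\<in>B \<times> B. f p * f q)"
            by (simp add: sum_product sum.cartesian_product)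
          then show ?thesis by (simp add: sum_distrib_right case_prod_unfold)
        qed
        show ?thesis unfolding m_sum case_prod_unfold * ..
      qed
      also have "\<dots> = (\<Sum>(p, q)\<in>(A \<times> A) \<times> (A \<times> A). e (dot s (?w (fst p) (snd p) (fst q) (snd q))))"
        unfolding e_def unit_char_add[symmetric] dot_add[symmetric] ..
      finally show "complex_of_real ((m s)\<^sup>2) * e (dot s ?v) =
          (\<Sum>((a, b), (c, d))\<in>(A \<times> A) \<times> (A \<times> A). e (dot s (?w a b c d)))"
        by (simp add: case_prod_unfold)
    qed
    also have "\<dots> = (\<Sum>((a, b), (c, d))\<in>(A \<times> A) \<times> (A \<times> A). \<Sum>s\<in>X. e (dot s (?w a b c d)))"
      unfolding case_prod_unfold by (rule sum.swap)
    also have "\<dots> = 0"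
    proof (rule sum.neutral, clarify)
      fix a b c d assume abcd: "a \<in> A" "b \<in> A" "c \<in> A" "d \<in> A"
      have "?w a b c d g = int (v g) + int (a g) + int (c g) - int (b g) - int (d g)" for g
        by simp
      then have "\<not> (\<forall>g\<in>F. int n dvd ?w a b c d g)"
        using contra abcd by metis
      then show "(\<Sum>s\<in>X. e (dot s (?w a b c d))) = 0"
        unfolding orth by (simp only: if_False)
    qed
    finally have Z0: "Z = 0" .
    have e1: "e (dot s ?v) = 1" if "s \<in> S" for s
    proof -
      have "dot s ?v = int (\<Sum>g\<in>F. s g * v g)" unfolding dot_def by simp
      then show ?thesis unfolding e_def using v[OF that] n unit_char_eq_1_iff int_dvd_int_iff by metis
    qed
    have "Z = (\<Sum>s\<in>S. complex_of_real ((m s)\<^sup>2) * e (dot s ?v)) + (\<Sum>s\<in>X - S. complex_of_real ((m s)\<^sup>2) * e (dot s ?v))"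
      unfolding Z_def using SX finX by (simp add: sum.subset_diff add.commute)
    then have "(\<Sum>s\<in>S. complex_of_real ((m s)\<^sup>2)) = - (\<Sum>s\<in>X - S. complex_of_real ((m s)\<^sup>2) * e (dot s ?v))"
      using Z0 e1 by (simp add: eq_neg_iff_add_eq_0)
    then have "cmod (complex_of_real (\<Sum>s\<in>S. (m s)\<^sup>2)) = cmod (\<Sum>s\<in>X - S. complex_of_real ((m s)\<^sup>2) * e (dot s ?v))"
      by simp
    also have "\<dots> \<le> (\<Sum>s\<in>X - S. cmod (complex_of_real ((m s)\<^sup>2) * e (dot s ?v)))"
      by (rule norm_sum)
    also have "\<dots> = (\<Sum>s\<in>X - S. (m s)\<^sup>2)"
      unfolding e_def by (simp add: norm_mult norm_power)
    also have "\<dots> \<le> (\<Sum>s\<in>X - S. \<tau> * m s)"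
      unfolding power2_eq_square by (intro sum_mono mult_right_mono) (auto simp: S_def m_nonneg)
    also have "\<dots> = \<tau> * (\<Sum>s\<in>X - S. m s)" by (simp add: sum_distrib_left)
    \<comment> \<open>Dropping only the trivial character, which lies in \<open>S\<close>, removes a
      positive share from Parseval's sum; this is what makes the estimate strict.\<close>
    also have "\<dots> \<le> \<tau> * (\<Sum>s\<in>X - {o0}. m s)"
      using \<tau>pos finX m_nonneg \<open>o0 \<in> S\<close> by (intro mult_left_mono sum_mono2) auto
    also have "(\<Sum>s\<in>X - {o0}. m s) = real N * real (card A) - (real (card A))\<^sup>2"
      using parseval m0 finX o0X by (simp add: sum_diff1)
    also have "\<tau> * (real N * real (card A) - (real (card A))\<^sup>2) < \<tau> * (real N * real (card A))"
      using \<tau>pos Apos by simp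
    also have "\<dots> = (m o0)\<^sup>2"
      unfolding \<tau>_def m0 using Npos by (simp add: power_def field_simps numeral_eq_Suc)
    also have "\<dots> \<le> (\<Sum>s\<in>S. (m s)\<^sup>2)"
      using \<open>o0 \<in> S\<close> finS by (intro member_le_sum) auto
    also have "\<dots> \<le> cmod (complex_of_real (\<Sum>s\<in>S. (m s)\<^sup>2))"
      unfolding norm_of_real by (rule abs_ge_self)
    finally show False by simp
  qed
  show thesis
  proof (rule that[of S])
    show "S \<subseteq> F \<rightarrow>\<^sub>E {..<n}" using SX unfolding X_def .
    show "S \<noteq> {}" using \<open>o0 \<in> S\<close> by blast
    show "card S \<le> k ^ 2" by (rule cardS)
  qed (use main in blast)
qed

section \<open>Torsion rings\<close>

context compact_semiring
begin

text \<open>Lists allow repeated terms, and their concatenation matches addition; both are needed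
  when a subgroup is built from such sums.\<close>

definition list_sum :: "'a list \<Rightarrow> 'a" where
  "list_sum xs = foldr (\<oplus>) xs \<zero>"

lemma list_sum_simps [simp]: "list_sum [] = \<zero>" "list_sum (x # xs) = x \<oplus> list_sum xs"
  unfolding list_sum_def by simp_all

lemma list_sum_closed: "set xs \<subseteq> R \<Longrightarrow> list_sum xs \<in> R"
  by (induction xs) auto

lemma list_sum_append:
  "set xs \<subseteq> R \<Longrightarrow> set ys \<subseteq> R \<Longrightarrow> list_sum (xs @ ys) = list_sum xs \<oplus> list_sum ys"
  by (induction xs) (simp_all add: list_sum_closed add_assoc)

lemma list_sum_replicate: "list_sum (replicate n x) = nmul n x"
  by (induction n) auto

text \<open>The additive map from coordinate vectors to \<open>R\<close>. When \<open>n\<close>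
  kills \<open>R\<close> it factors through \<open>(Z/n)^F\<close> and so transports Bogolyubov's
  lemma.\<close>

definition lincomb :: "'a list \<Rightarrow> ('a \<Rightarrow> nat) \<Rightarrow> 'a" where
  "lincomb gs v = list_sum (map (\<lambda>g. nmul (v g) g) gs)"

lemma lincomb_simps [simp]:
  "lincomb [] v = \<zero>" "lincomb (g # gs) v = nmul (v g) g \<oplus> lincomb gs v"
  unfolding lincomb_def by simp_all

lemma lincomb_closed: "set gs \<subseteq> R \<Longrightarrow> lincomb gs v \<in> R"
  by (induction gs) auto

lemma lincomb_add:
  "set gs \<subseteq> R \<Longrightarrow> lincomb gs (\<lambda>g. v g + w g) = lincomb gs v \<oplus> lincomb gs w"
proof (induction gs)
  case (Cons g gs)
  then have "lincomb gs v \<in> R" "lincomb gs w \<in> R" "g \<in> R" by (simp_all add: lincomb_closed)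
  then show ?case using Cons by (simp add: nmul_add add_ac)
qed simp

lemma lincomb_cong: "(\<And>g. g \<in> set gs \<Longrightarrow> nmul (v g) g = nmul (w g) g) \<Longrightarrow> lincomb gs v = lincomb gs w"
  unfolding lincomb_def by (metis (no_types, lifting) map_cong)

lemma lincomb_zero: "lincomb gs (\<lambda>_. 0) = \<zero>"
  by (induction gs) auto

lemma lincomb_unit:
  "distinct gs \<Longrightarrow> set gs \<subseteq> R \<Longrightarrow> x \<in> set gs \<Longrightarrow> lincomb gs (\<lambda>g. if g = x then 1 else 0) = x"
proof (induction gs)
  case (Cons g gs)
  show ?case
  proof (cases "g = x")
    case True
    then have "lincomb gs (\<lambda>g. if g = x then 1 else 0) = lincomb gs (\<lambda>_. 0)"
      using Cons.prems by (intro lincomb_cong) auto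
    then show ?thesis using True Cons.prems by (simp add: lincomb_zero)
  next
    case False
    then show ?thesis using Cons by auto
  qed
qed simp

lemma list_sum_eq_lincomb:
  assumes "distinct gs" "set gs \<subseteq> R" "set xs \<subseteq> set gs"
  shows "list_sum xs = lincomb gs (count_list xs)"
  using assms(3)
proof (induction xs)
  case Nil
  then show ?case by (simp add: lincomb_zero)
next
  case (Cons x xs)
  have "count_list (x # xs) = (\<lambda>g. (if g = x then 1 else 0) + count_list xs g)"
    by auto
  then have "lincomb gs (count_list (x # xs)) = x \<oplus> lincomb gs (count_list xs)"
    using lincomb_add[OF assms(2)] lincomb_unit[OF assms(1,2)] Cons.prems by simp
  moreover have "list_sum xs = lincomb gs (count_list xs)" using Cons by simp
  ultimately show ?case by (simp only: list_sum_simps)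
qed

lemma nmul_cong_mod:
  assumes "\<And>x. x \<in> R \<Longrightarrow> nmul n x = \<zero>" "x \<in> R" "a mod n = b mod n"
  shows "nmul a x = nmul b x"
proof -
  have "nmul a x = nmul (a mod n) x" for a
    using nmul_add[OF assms(2), of "a div n * n" "a mod n"] nmul_mult[OF assms(2), of "a div n" n] assms(1,2)
    by simp
  then show ?thesis using assms(3) by metis
qed

end

section \<open>From colourings of finite sets to an open subgroup\<close>

context simple_compact_ring
begin

text \<open>The colour of \<open>x\<close> records the values of Bogolyubov's characters at the
  basis vector of \<open>x\<close>. If the colours of a list add up to zero modulo \<open>n\<close>,
  its vector of multiplicities is killed by all these characters, so its sum is a difference of two
  sums of pairs from \<open>W\<close>. The number \<open>card G ^ 2\<close> of characters does not
  grow with \<open>F\<close>.\<close>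

lemma colouring_finite:
  assumes n: "n > 0" and exp: "\<And>x. x \<in> R \<Longrightarrow> nmul n x = \<zero>"
    and W: "W \<subseteq> R" and G: "finite G" "G \<subseteq> R" and cover: "\<And>y. y \<in> R \<Longrightarrow> \<exists>c\<in>G. \<exists>w\<in>W. y = c \<oplus> w"
    and F: "finite F" "F \<subseteq> R"
  obtains c where "\<forall>x\<in>F. c x \<in> {..<card G ^ 2} \<rightarrow>\<^sub>E {..<n}"
    "\<forall>xs. set xs \<subseteq> F \<longrightarrow> (\<forall>i<card G ^ 2. n dvd (\<Sum>x\<leftarrow>xs. c x i)) \<longrightarrow>
      (\<exists>w1\<in>W. \<exists>w2\<in>W. \<exists>w3\<in>W. \<exists>w4\<in>W. w1 \<oplus> w2 \<oplus> list_sum xs = w3 \<oplus> w4)"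
proof -
  obtain gs where gs: "distinct gs" "set gs = F" using F(1) finite_distinct_list by blast
  have gsR: "set gs \<subseteq> R" using gs F by simp
  define X where "X = F \<rightarrow>\<^sub>E {..<n}"
  have finX: "finite X" unfolding X_def using F by (simp add: finite_PiE)
  \<comment> \<open>Coordinate vectors that land in the translate of \<open>W\<close> by
    \<open>c\<close>. The translates by \<open>G\<close> cover \<open>R\<close>, so one of these
    sets has density at least \<open>1 / card G\<close>.\<close>
  define A where "A = (\<lambda>c. {v \<in> X. \<exists>w\<in>W. lincomb gs v = c \<oplus> w})"
  have "\<exists>c\<in>G. card X \<le> card G * card (A c)"
  proof (rule ccontr)
    assume "\<not> ?thesis"
    then have lt: "card G * card (A c) < card X" if "c \<in> G" for c using that by force
    have "X \<subseteq> (\<Union>c\<in>G. A c)"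
      using cover lincomb_closed[OF gsR] unfolding A_def by blast
    then have "card X \<le> card (\<Union>c\<in>G. A c)"
      using finX G unfolding A_def by (intro card_mono) auto
    also have "\<dots> \<le> (\<Sum>c\<in>G. card (A c))"
      using G(1) by (rule card_UN_le)
    finally have *: "card X \<le> (\<Sum>c\<in>G. card (A c))" .
    moreover have "G \<noteq> {}" using cover zero_closed by blast
    then have "(\<Sum>c\<in>G. card G * card (A c)) < (\<Sum>c\<in>G. card X)"
      using lt G(1) by (intro sum_strict_mono) auto
    then have "card G * (\<Sum>c\<in>G. card (A c)) < card G * card X"
      by (simp add: sum_distrib_left)
    then show False using * by simp
  qed
  then obtain c0 where c0: "c0 \<in> G" "card X \<le> card G * card (A c0)" by blast
  have c0R: "c0 \<in> R" using c0 G by blast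
  have "A c0 \<subseteq> F \<rightarrow>\<^sub>E {..<n}" unfolding A_def X_def by blast
  then obtain S where S: "S \<subseteq> F \<rightarrow>\<^sub>E {..<n}" "S \<noteq> {}" "card S \<le> card G ^ 2"
    and bog: "\<forall>v :: 'a \<Rightarrow> nat. (\<forall>s\<in>S. n dvd (\<Sum>g\<in>F. s g * v g)) \<longrightarrow>
       (\<exists>a\<in>A c0. \<exists>b\<in>A c0. \<exists>c\<in>A c0. \<exists>d\<in>A c0. \<forall>g\<in>F. int n dvd int (v g) + int (a g) + int (c g) - int (b g) - int (d g))"
    by (rule bogolyubov[OF n F(1) _ c0(2)[unfolded X_def]])
  have finS: "finite S" using S(1) finX unfolding X_def by (rule finite_subset)
  obtain b where b: "bij_betw b {..<card S} S"
    using ex_bij_betw_nat_finite[OF finS] by (auto simp: atLeast0LessThan)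
  have cS: "card S > 0" using S finS by (simp add: card_gt_0_iff)
  \<comment> \<open>The enumeration of \<open>S\<close> is padded by repeating one member, so that
    colours have exactly \<open>card G ^ 2\<close> entries for every \<open>F\<close>.\<close>
  define f where "f = (\<lambda>i. if i < card S then b i else b 0)"
  have f: "f i \<in> S" for i
    unfolding f_def using bij_betwE[OF b] cS by auto
  have fsurj: "\<exists>i < card G ^ 2. f i = s" if s: "s \<in> S" for s
  proof -
    have "s \<in> b ` {..<card S}" using b s unfolding bij_betw_def by simp
    then obtain i where "i < card S" "b i = s" by auto
    then show ?thesis using S(3) unfolding f_def by (intro exI[of _ i]) auto
  qed
  define c where "c = (\<lambda>x. \<lambda>i\<in>{..<card G ^ 2}. f i x)"
  show thesis
  proof (rule that[of c]; intro ballI allI impI)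
    fix x assume x: "x \<in> F"
    show "c x \<in> {..<card G ^ 2} \<rightarrow>\<^sub>E {..<n}"
      unfolding c_def restrict_PiE_iff using PiE_mem[OF subsetD[OF S(1) f] x] by blast
  next
    fix xs assume xs: "set xs \<subseteq> F" and ker: "\<forall>i<card G ^ 2. n dvd (\<Sum>x\<leftarrow>xs. c x i)"
    define v where "v = count_list xs"
    have "n dvd (\<Sum>g\<in>F. s g * v g)" if s: "s \<in> S" for s
    proof -
      obtain i where i: "i < card G ^ 2" "f i = s" using fsurj[OF s] by blast
      have "(\<Sum>x\<leftarrow>xs. c x i) = (\<Sum>x\<leftarrow>xs. s x)" unfolding c_def using i by simp
      also have "\<dots> = (\<Sum>g\<in>F. count_list xs g * s g)"
        using xs F(1) by (rule sum_list_map_eq_sum_count2)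
      also have "\<dots> = (\<Sum>g\<in>F. s g * v g)" unfolding v_def by (simp add: mult.commute)
      finally show ?thesis using ker i(1) by metis
    qed
    then have "\<exists>a\<in>A c0. \<exists>b\<in>A c0. \<exists>c\<in>A c0. \<exists>d\<in>A c0. \<forall>g\<in>F. int n dvd int (v g) + int (a g) + int (c g) - int (b g) - int (d g)"
      using bog by simp
    then obtain a1 a2 a3 a4 where a: "a1 \<in> A c0" "a2 \<in> A c0" "a3 \<in> A c0" "a4 \<in> A c0"
      and rel: "\<And>g. g \<in> F \<Longrightarrow> int n dvd int (v g) + int (a1 g) + int (a3 g) - int (a2 g) - int (a4 g)"
      by blast
    have "lincomb gs (\<lambda>g. v g + (a1 g + a3 g)) = lincomb gs (\<lambda>g. a2 g + a4 g)"
    proof (rule lincomb_cong)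
      fix g assume "g \<in> set gs"
      then have g: "g \<in> F" "g \<in> R" using gs gsR by auto
      have "int (v g + (a1 g + a3 g)) mod int n = int (a2 g + a4 g) mod int n"
        using rel[OF g(1)] by (simp add: mod_eq_dvd_iff algebra_simps)
      then have "(v g + (a1 g + a3 g)) mod n = (a2 g + a4 g) mod n"
        by (metis nat_int zmod_int)
      then show "nmul (v g + (a1 g + a3 g)) g = nmul (a2 g + a4 g) g"
        using nmul_cong_mod[OF exp g(2)] by blast
    qed
    then have eq: "lincomb gs v \<oplus> (lincomb gs a1 \<oplus> lincomb gs a3) = lincomb gs a2 \<oplus> lincomb gs a4"
      using gsR by (simp add: lincomb_add)
    obtain w1 w2 w3 w4 where w: "w1 \<in> W" "w2 \<in> W" "w3 \<in> W" "w4 \<in> W"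
      "lincomb gs a1 = c0 \<oplus> w1" "lincomb gs a2 = c0 \<oplus> w2" "lincomb gs a3 = c0 \<oplus> w3" "lincomb gs a4 = c0 \<oplus> w4"
      using a unfolding A_def by blast
    have wR: "w1 \<in> R" "w2 \<in> R" "w3 \<in> R" "w4 \<in> R" using w W by auto
    have vR: "lincomb gs v \<in> R" using gsR by (rule lincomb_closed)
    \<comment> \<open>Bogolyubov's relation has two terms from \<open>A c0\<close> on each side, so
      the unknown translation \<open>c0\<close> occurs twice on both and cancels.\<close>
    have "(c0 \<oplus> c0) \<oplus> (w1 \<oplus> w3 \<oplus> lincomb gs v) = (c0 \<oplus> c0) \<oplus> (w2 \<oplus> w4)"
    proof -
      have "(c0 \<oplus> c0) \<oplus> (w1 \<oplus> w3 \<oplus> lincomb gs v) = lincomb gs v \<oplus> ((c0 \<oplus> w1) \<oplus> (c0 \<oplus> w3))"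
        using wR vR c0R by (simp add: add_ac)
      also have "\<dots> = (c0 \<oplus> w2) \<oplus> (c0 \<oplus> w4)" using eq unfolding w(5-8) .
      also have "\<dots> = (c0 \<oplus> c0) \<oplus> (w2 \<oplus> w4)" using wR c0R by (simp add: add_ac)
      finally show ?thesis .
    qed
    then have "w1 \<oplus> w3 \<oplus> lincomb gs v = w2 \<oplus> w4"
      using wR vR c0R by (subst (asm) add_left_cancel) auto
    moreover have "list_sum xs = lincomb gs v"
      unfolding v_def using list_sum_eq_lincomb[OF gs(1) gsR] xs gs(2) by simp
    ultimately show "\<exists>w1\<in>W. \<exists>w2\<in>W. \<exists>w3\<in>W. \<exists>w4\<in>W. w1 \<oplus> w2 \<oplus> list_sum xs = w3 \<oplus> w4"
      using w(1-4) by metis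
  qed
qed

text \<open>Colourings of \<open>R\<close> form a product of finite discrete spaces, compact by
  Tychonoff. The condition for one list involves finitely many coordinates, so it is closed, and
  finitely many conditions are met by a colouring of a finite \<open>F\<close>.\<close>

lemma colouring_compactness:
  fixes P :: "'a list \<Rightarrow> bool" and n d :: nat
  assumes n: "n > 0"
    and fin: "\<And>F. finite F \<Longrightarrow> F \<subseteq> R \<Longrightarrow> \<exists>c. (\<forall>x\<in>F. c x \<in> {..<d} \<rightarrow>\<^sub>E {..<n}) \<and>
      (\<forall>xs. set xs \<subseteq> F \<longrightarrow> (\<forall>i<d. n dvd (\<Sum>x\<leftarrow>xs. c x i)) \<longrightarrow> P xs)"
  obtains c where "\<forall>x\<in>R. c x \<in> {..<d} \<rightarrow>\<^sub>E {..<n}"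
    "\<forall>xs. set xs \<subseteq> R \<longrightarrow> (\<forall>i<d. n dvd (\<Sum>x\<leftarrow>xs. c x i)) \<longrightarrow> P xs"
proof -
  define K where "K = {..<d} \<rightarrow>\<^sub>E {..<n}"
  have finK: "finite K" unfolding K_def by (simp add: finite_PiE)
  define \<kappa> where "\<kappa> = (\<lambda>i\<in>{..<d}. 0 :: nat)"
  have \<kappa>: "\<kappa> \<in> K" unfolding K_def \<kappa>_def using n by auto
  define Y where "Y = product_topology (\<lambda>_ :: 'a. discrete_topology K) R"
  have Ysp: "topspace Y = R \<rightarrow>\<^sub>E K" unfolding Y_def by simp
  have Ycomp: "compact_space Y"
    unfolding Y_def compact_space_product_topology using finK by (simp add: compact_space_discrete_topology)
  define ker where "ker = (\<lambda>xs (c :: 'a \<Rightarrow> nat \<Rightarrow> nat). \<forall>i<d. n dvd (\<Sum>x\<leftarrow>xs. c x i))"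
  define D where "D = (\<lambda>xs. {c \<in> R \<rightarrow>\<^sub>E K. ker xs c \<longrightarrow> P xs})"
  have clD: "closedin Y (D xs)" if xs: "set xs \<subseteq> R" for xs
  proof (cases "P xs")
    case True
    then have "D xs = topspace Y" unfolding D_def Ysp by blast
    then show ?thesis by simp
  next
    case False
    have "openin Y {c \<in> R \<rightarrow>\<^sub>E K. ker xs c}"
    proof (subst openin_subopen, intro ballI)
      fix c assume c: "c \<in> {c \<in> R \<rightarrow>\<^sub>E K. ker xs c}"
      let ?U = "topspace Y \<inter> \<Inter>((\<lambda>x. {c' \<in> topspace Y. c' x \<in> {c x}}) ` set xs)"
      have "openin Y {c' \<in> topspace Y. c' x \<in> {c x}}" if "x \<in> set xs" for x
      proof (rule openin_continuous_map_preimage)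
        show "continuous_map Y (discrete_topology K) (\<lambda>c'. c' x)"
          unfolding Y_def using that xs by (intro continuous_map_product_projection) auto
        show "openin (discrete_topology K) {c x}" using c that xs by auto
      qed
      then have "openin Y ?U"
        by (cases "xs = []") (auto intro!: openin_Int openin_Inter)
      moreover have "c \<in> ?U" using c unfolding Ysp by blast
      moreover have "?U \<subseteq> {c \<in> R \<rightarrow>\<^sub>E K. ker xs c}"
      proof
        fix c' assume c': "c' \<in> ?U"
        then have "c' x = c x" if "x \<in> set xs" for x using that by blast
        then have "(\<Sum>x\<leftarrow>xs. c' x i) = (\<Sum>x\<leftarrow>xs. c x i)" for i
          by (intro arg_cong[of _ _ sum_list] map_cong) auto
        then have "ker xs c'" using c unfolding ker_def by simp
        then show "c' \<in> {c \<in> R \<rightarrow>\<^sub>E K. ker xs c}" using c' unfolding Ysp by blast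
      qed
      ultimately show "\<exists>U. openin Y U \<and> c \<in> U \<and> U \<subseteq> {c \<in> R \<rightarrow>\<^sub>E K. ker xs c}" by blast
    qed
    then have "closedin Y (topspace Y - {c \<in> R \<rightarrow>\<^sub>E K. ker xs c})" by blast
    moreover have "topspace Y - {c \<in> R \<rightarrow>\<^sub>E K. ker xs c} = D xs"
      unfolding D_def Ysp using False by blast
    ultimately show ?thesis by simp
  qed
  have "\<Inter>(D ` {xs. set xs \<subseteq> R}) \<noteq> {}"
  proof (rule Ycomp[unfolded compact_space_fip, rule_format], intro conjI ballI allI impI)
    fix C assume "C \<in> D ` {xs. set xs \<subseteq> R}"
    then show "closedin Y C" using clD by blast
  next
    fix \<F> assume "finite \<F> \<and> \<F> \<subseteq> D ` {xs. set xs \<subseteq> R}"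
    then have "finite \<F>" "\<F> \<subseteq> D ` {xs. set xs \<subseteq> R}" by auto
    from finite_subset_image[OF this]
    obtain L where L: "L \<subseteq> {xs. set xs \<subseteq> R}" "finite L" "\<F> = D ` L" by (elim exE conjE)
    define F where "F = (\<Union>xs\<in>L. set xs)"
    have F: "finite F" "F \<subseteq> R" unfolding F_def using L by auto
    obtain c where c: "\<forall>x\<in>F. c x \<in> K" "\<forall>xs. set xs \<subseteq> F \<longrightarrow> ker xs c \<longrightarrow> P xs"
      using fin[OF F] unfolding K_def ker_def by blast
    \<comment> \<open>Extension by a default colour; the finitely many lists at hand have all their
      entries in \<open>F\<close>.\<close>
    define c' where "c' = (\<lambda>x\<in>R. if x \<in> F then c x else \<kappa>)"
    have c'K: "c' \<in> R \<rightarrow>\<^sub>E K" unfolding c'_def using c(1) \<kappa> by auto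
    have "c' \<in> D xs" if xs: "xs \<in> L" for xs
    proof -
      have xsF: "set xs \<subseteq> F" unfolding F_def using xs by blast
      have "(\<Sum>x\<leftarrow>xs. c' x i) = (\<Sum>x\<leftarrow>xs. c x i)" for i
        unfolding c'_def using xsF F(2) by (intro arg_cong[of _ _ sum_list] map_cong) auto
      then have "ker xs c' \<longleftrightarrow> ker xs c" unfolding ker_def by simp
      then show ?thesis unfolding D_def using c(2) xsF c'K by blast
    qed
    then show "\<Inter>\<F> \<noteq> {}" unfolding L(3) by blast
  qed
  then obtain c where c: "\<And>xs. set xs \<subseteq> R \<Longrightarrow> c \<in> D xs" by blast
  have "c \<in> D []" using c by simp
  then have "c \<in> R \<rightarrow>\<^sub>E K" unfolding D_def by blast
  then have "c x \<in> K" if "x \<in> R" for x using that by blast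
  then have "\<forall>x\<in>R. c x \<in> {..<d} \<rightarrow>\<^sub>E {..<n}" unfolding K_def by blast
  moreover have "\<forall>xs. set xs \<subseteq> R \<longrightarrow> (\<forall>i<d. n dvd (\<Sum>x\<leftarrow>xs. c x i)) \<longrightarrow> P xs"
    using c unfolding D_def ker_def by blast
  ultimately show thesis by (rule that)
qed

text \<open>Sums of lists whose colours add up to zero modulo \<open>n\<close> form a subgroup, and elements of equal
  colour lie in the same coset of it; so it has finite index although it stays inside \<open>C\<close>.\<close>

lemma finite_if_torsion:
  assumes n: "n > 0" and exp: "\<And>x. x \<in> R \<Longrightarrow> nmul n x = \<zero>"
  shows "finite R"
proof (cases "R = {\<zero>}")
  case True
  then show ?thesis by (metis finite.emptyI finite_insert)
next
  case False
  obtain x1 where x1: "x1 \<in> R" "x1 \<noteq> \<zero>" using False zero_closed by blast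
  have "openin T (R - {x1})" "\<zero> \<in> R - {x1}" using openin_delete x1 by auto
  then obtain V C where V: "openin T V" "closedin T C" "\<zero> \<in> V" "V \<subseteq> C" "C \<subseteq> R - {x1}"
    by (rule closed_nbhd)
  \<comment> \<open>Two refinements, so that sums of two elements of \<open>W\<close> differ by an
    element of \<open>V\<close>, as \<open>colouring_finite\<close> requires. Since \<open>C\<close>
    misses \<open>x1\<close>, the resulting subgroup is proper.\<close>
  obtain O1 where O1: "openin T O1" "\<zero> \<in> O1" "\<And>x y. x \<in> O1 \<Longrightarrow> y \<in> O1 \<Longrightarrow> x \<ominus> y \<in> V"
    using diff_nbhd[OF V(1,3)] by blast
  have "continuous_map (prod_topology T T) T (\<lambda>p. fst p \<oplus> snd p)"
    by (rule cont_intros)+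
  then obtain W where W: "openin T W" "\<zero> \<in> W" "\<And>x y. x \<in> W \<Longrightarrow> y \<in> W \<Longrightarrow> x \<oplus> y \<in> O1"
    using square_nbhd[of "(\<oplus>)" O1 \<zero>] O1(1,2) by auto
  have WR: "W \<subseteq> R" using W(1) by (rule openin_subset)
  let ?N = "\<lambda>c. {y \<in> R. y \<ominus> c \<in> W}"
  have "R \<subseteq> \<Union>(?N ` R)" using W(2) by auto
  moreover have "\<And>B. B \<in> ?N ` R \<Longrightarrow> openin T B"
    using openin_translate W(1) by blast
  ultimately obtain \<F> where \<F>: "finite \<F>" "\<F> \<subseteq> ?N ` R" "R \<subseteq> \<Union>\<F>"
    using compact unfolding compact_space_alt by meson
  from finite_subset_image[OF \<F>(1,2)]
  obtain G where G: "G \<subseteq> R" "finite G" "\<F> = ?N ` G" by (elim exE conjE)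
  have cover: "\<exists>c\<in>G. \<exists>w\<in>W. y = c \<oplus> w" if y: "y \<in> R" for y
  proof -
    obtain c where c: "c \<in> G" "y \<ominus> c \<in> W" using \<F>(3) y unfolding G(3) by blast
    then have "y = c \<oplus> (y \<ominus> c)" using add_diff[OF y, of c] G(1) by auto
    then show ?thesis using c by blast
  qed
  define d where "d = card G ^ 2"
  have "\<exists>c. (\<forall>x\<in>F. c x \<in> {..<d} \<rightarrow>\<^sub>E {..<n}) \<and>
      (\<forall>xs. set xs \<subseteq> F \<longrightarrow> (\<forall>i<d. n dvd (\<Sum>x\<leftarrow>xs. c x i)) \<longrightarrow> list_sum xs \<in> C)"
    if F: "finite F" "F \<subseteq> R" for F
  proof -
    obtain c where c: "\<forall>x\<in>F. c x \<in> {..<d} \<rightarrow>\<^sub>E {..<n}"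
      "\<forall>xs. set xs \<subseteq> F \<longrightarrow> (\<forall>i<d. n dvd (\<Sum>x\<leftarrow>xs. c x i)) \<longrightarrow>
        (\<exists>w1\<in>W. \<exists>w2\<in>W. \<exists>w3\<in>W. \<exists>w4\<in>W. w1 \<oplus> w2 \<oplus> list_sum xs = w3 \<oplus> w4)"
      unfolding d_def by (rule colouring_finite[OF n exp WR G(2,1) cover F])
    have "list_sum xs \<in> C" if xs: "set xs \<subseteq> F" and ker: "\<forall>i<d. n dvd (\<Sum>x\<leftarrow>xs. c x i)" for xs
    proof -
      obtain w1 w2 w3 w4 where w: "w1 \<in> W" "w2 \<in> W" "w3 \<in> W" "w4 \<in> W" "w1 \<oplus> w2 \<oplus> list_sum xs = w3 \<oplus> w4"
        using c(2) xs ker by meson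
      have "list_sum xs \<in> R" using xs F(2) by (intro list_sum_closed) blast
      moreover have "w1 \<oplus> w2 \<in> R" using w WR by blast
      ultimately have "(w3 \<oplus> w4) \<ominus> (w1 \<oplus> w2) = list_sum xs" using w(5) by (rule diff_unique)
      moreover have "(w3 \<oplus> w4) \<ominus> (w1 \<oplus> w2) \<in> V" using O1(3) W(3) w(1-4) by blast
      ultimately show ?thesis using V(4) by auto
    qed
    then show ?thesis using c(1) by blast
  qed
  then obtain c where c: "\<forall>x\<in>R. c x \<in> {..<d} \<rightarrow>\<^sub>E {..<n}"
    "\<forall>xs. set xs \<subseteq> R \<longrightarrow> (\<forall>i<d. n dvd (\<Sum>x\<leftarrow>xs. c x i)) \<longrightarrow> list_sum xs \<in> C"
    by (rule colouring_compactness[OF n, where P = "\<lambda>xs. list_sum xs \<in> C" and d = d])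
  define H where "H = list_sum ` {xs. set xs \<subseteq> R \<and> (\<forall>i<d. n dvd (\<Sum>x\<leftarrow>xs. c x i))}"
  define A where "A = T closure_of H"
  have HR: "H \<subseteq> R" unfolding H_def using list_sum_closed by blast
  have HA: "H \<subseteq> A" unfolding A_def using HR by (rule closure_of_subset)
  have HC: "H \<subseteq> C" unfolding H_def using c(2) by blast
  have AC: "A \<subseteq> C" unfolding A_def using HC V(2) by (rule closure_of_minimal)
  have clA: "closedin T A" unfolding A_def by simp
  have AR: "A \<subseteq> R" using clA by (rule closedin_subset)
  have 0: "\<zero> \<in> A"
  proof -
    have "list_sum [] \<in> H" unfolding H_def by (rule imageI) simp
    then show ?thesis using HA by auto
  qed
  have plus: "x \<oplus> y \<in> A" if xy: "x \<in> A" "y \<in> A" for x y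
    unfolding A_def
  proof (rule closure_of_add[OF HR])
    fix a b assume "a \<in> H" "b \<in> H"
    then obtain xs ys where
      xs: "set xs \<subseteq> R" "\<forall>i<d. n dvd (\<Sum>x\<leftarrow>xs. c x i)" "a = list_sum xs" and
      ys: "set ys \<subseteq> R" "\<forall>i<d. n dvd (\<Sum>x\<leftarrow>ys. c x i)" "b = list_sum ys"
      unfolding H_def by blast
    have "a \<oplus> b = list_sum (xs @ ys)" using xs ys by (simp add: list_sum_append)
    moreover have "xs @ ys \<in> {xs. set xs \<subseteq> R \<and> (\<forall>i<d. n dvd (\<Sum>x\<leftarrow>xs. c x i))}"
      using xs ys by simp
    ultimately show "a \<oplus> b \<in> H" unfolding H_def by blast
  qed (use xy in \<open>simp_all add: A_def\<close>)
  \<comment> \<open>With \<open>m = n - 1\<close>, \<open>nmul m g\<close> is the negative of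
    \<open>g\<close>.\<close>
  obtain m where m: "n = Suc m" using n gr0_conv_Suc by blast
  have same_colour: "y \<oplus> nmul m g \<in> A" if yg: "y \<in> R" "g \<in> R" "c y = c g" for y g
  proof -
    have "(\<Sum>x\<leftarrow>y # replicate m g. c x i) = n * c g i" for i
      unfolding m using yg(3) by (simp add: sum_list_replicate)
    then have "y # replicate m g \<in> {xs. set xs \<subseteq> R \<and> (\<forall>i<d. n dvd (\<Sum>x\<leftarrow>xs. c x i))}"
      using yg(1,2) by auto
    then have "list_sum (y # replicate m g) \<in> H" unfolding H_def by (rule imageI)
    then show ?thesis using HA by (auto simp: list_sum_replicate)
  qed
  have cancel: "g \<oplus> (y \<oplus> nmul m g) = y" if "y \<in> R" "g \<in> R" for y g
  proof -
    have "g \<oplus> (y \<oplus> nmul m g) = y \<oplus> nmul n g"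
      unfolding m using that by (simp add: add_ac)
    then show ?thesis using exp that by simp
  qed
  have "finite (c ` R)"
  proof (rule finite_subset)
    show "c ` R \<subseteq> {..<d} \<rightarrow>\<^sub>E {..<n}" using c(1) by blast
  qed (simp add: finite_PiE)
  from finite_subset_image[OF this subset_refl]
  obtain B where B: "B \<subseteq> R" "finite B" "c ` R = c ` B" by (elim exE conjE)
  \<comment> \<open>Every colour occurs in the finite set \<open>B\<close>, so the complement of
    \<open>A\<close> is a finite union of closed cosets, and \<open>A\<close> is open.\<close>
  have "R - A = (\<Union>g\<in>B - A. (\<lambda>a. g \<oplus> a) ` A)"
  proof (intro equalityI subsetI)
    fix y assume y: "y \<in> R - A"
    then obtain g where g: "g \<in> B" "c y = c g" using B(3) by blast
    have gR: "g \<in> R" using g B by blast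
    have yA: "y \<oplus> nmul m g \<in> A" using same_colour y gR g by blast
    have y_eq: "y = g \<oplus> (y \<oplus> nmul m g)" using cancel[of y g] y gR by simp
    have "g \<notin> A"
    proof
      assume "g \<in> A"
      then have "g \<oplus> (y \<oplus> nmul m g) \<in> A" using yA by (rule plus)
      then show False using y y_eq by simp
    qed
    then show "y \<in> (\<Union>g\<in>B - A. (\<lambda>a. g \<oplus> a) ` A)" using g yA y_eq by blast
  next
    fix y assume "y \<in> (\<Union>g\<in>B - A. (\<lambda>a. g \<oplus> a) ` A)"
    then obtain g a where ga: "g \<in> B" "g \<notin> A" "a \<in> A" "y = g \<oplus> a" by blast
    have R: "g \<in> R" "a \<in> R" using ga B AR by auto
    have "y \<notin> A"
    proof
      assume "y \<in> A"
      moreover have "nmul m a \<in> A" using 0 plus ga(3) by (rule nmul_in_submonoid)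
      ultimately have "y \<oplus> nmul m a \<in> A" by (rule plus)
      moreover have "y \<oplus> nmul m a = g" unfolding ga(4) using cancel[OF R] R by (simp add: add_ac)
      ultimately show False using ga(2) by simp
    qed
    then show "y \<in> R - A" using ga(4) R by simp
  qed
  moreover have "closedin T (\<Union>g\<in>B - A. (\<lambda>a. g \<oplus> a) ` A)"
  proof (rule closedin_Union)
    show "finite ((\<lambda>g. (\<lambda>a. g \<oplus> a) ` A) ` (B - A))" using B(2) by simp
    fix S assume "S \<in> (\<lambda>g. (\<lambda>a. g \<oplus> a) ` A) ` (B - A)"
    then obtain g where g: "g \<in> R" "S = (\<lambda>a. g \<oplus> a) ` A" using B(1) by blast
    then show "closedin T S"
      using clA by (auto intro!: closedin_image continuous_map_add)
  qed
  ultimately have "openin T A"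
    using AR by (simp add: openin_closedin_eq)
  moreover have "x1 \<notin> A" using AC V(5) by blast
  ultimately show ?thesis using finite_if_clopen[of A \<zero> x1] clA 0 x1 by blast
qed

end

section \<open>Divisible rings\<close>

context simple_compact_ring
begin

text \<open>Some \<open>nmul n x\<close> is so close to zero that its products with all of
  \<open>R\<close> avoid \<open>x \<odot> y\<close>. Writing \<open>y = nmul n v\<close> and moving
  \<open>n\<close> across the product contradicts this.\<close>

lemma mul_zero_if_divisible:
  assumes div: "\<And>n. n > 0 \<Longrightarrow> nmul n ` R = R" and x: "x \<in> R" and y: "y \<in> R"
  shows "x \<odot> y = \<zero>"
proof (rule ccontr)
  assume ne: "x \<odot> y \<noteq> \<zero>"
  let ?O = "R - {x \<odot> y}"
  let ?P = "{p \<in> topspace (prod_topology T T). fst p \<odot> snd p \<in> ?O}"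
  have "continuous_map (prod_topology T T) T (\<lambda>p. fst p \<odot> snd p)"
    by (rule cont_intros)+
  then have "openin (prod_topology T T) ?P"
    using openin_delete by (rule openin_continuous_map_preimage)
  then have "openin T {u \<in> R. \<forall>v\<in>R. (u, v) \<in> ?P}"
    using compact by (rule openin_ball_compact)
  moreover have "\<zero> \<in> {u \<in> R. \<forall>v\<in>R. (u, v) \<in> ?P}"
    using ne by simp
  ultimately obtain n where n: "n > 0" "nmul n x \<in> {u \<in> R. \<forall>v\<in>R. (u, v) \<in> ?P}"
    by (rule recurrence[OF x])
  from div[OF n(1)] y obtain v where v: "v \<in> R" "y = nmul n v" by blast
  have "(nmul n x, v) \<in> ?P" using n(2) v(1) by blast
  then have "nmul n x \<odot> v \<noteq> x \<odot> y" by simp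
  moreover have "nmul n x \<odot> v = x \<odot> y"
    using x v by (simp add: mul_nmul_left mul_nmul_right)
  ultimately show False by blast
qed

text \<open>A substitute for the ball of radius \<open>1/k\<close>. When multiplication vanishes and
  \<open>V\<close> is a closed neighbourhood of zero other than \<open>R\<close>, these sets form a
  neighbourhood base at zero.\<close>

definition multiples_in :: "nat \<Rightarrow> 'a set \<Rightarrow> 'a set" where
  "multiples_in k V = {x \<in> R. \<forall>j\<le>k. nmul j x \<in> V}"

lemma multiples_in_mono: "j \<le> k \<Longrightarrow> multiples_in k V \<subseteq> multiples_in j V"
  unfolding multiples_in_def by auto

lemma closedin_multiples_in:
  assumes "closedin T V"
  shows "closedin T (multiples_in k V)"
proof -
  have "closedin T (\<Inter>j\<le>k. {x \<in> R. nmul j x \<in> V})"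
    using assms by (intro closedin_Inter) (auto intro!: closedin_continuous_map_preimage continuous_map_nmul)
  moreover have "(\<Inter>j\<le>k. {x \<in> R. nmul j x \<in> V}) = multiples_in k V"
    unfolding multiples_in_def by auto
  ultimately show ?thesis by simp
qed

lemma openin_multiples_in:
  assumes "openin T V"
  shows "openin T (multiples_in k V)"
proof -
  have "openin T (\<Inter>j\<le>k. {x \<in> R. nmul j x \<in> V})"
    using assms by (intro openin_Inter) (auto intro!: openin_continuous_map_preimage continuous_map_nmul)
  moreover have "(\<Inter>j\<le>k. {x \<in> R. nmul j x \<in> V}) = multiples_in k V"
    unfolding multiples_in_def by auto
  ultimately show ?thesis by simp
qed

text \<open>The closure of the multiples of \<open>x\<close> is a closed submonoid inside
  \<open>V\<close>. Recurrence makes it a group, and with vanishing multiplication a closed subgroup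
  is a subtractive ideal.\<close>

lemma no_small_submonoid:
  assumes mul0: "\<And>x y. x \<in> R \<Longrightarrow> y \<in> R \<Longrightarrow> x \<odot> y = \<zero>"
    and V: "closedin T V" "V \<noteq> R" and x: "x \<in> R" "\<And>j. nmul j x \<in> V"
  shows "x = \<zero>"
proof -
  define H where "H = range (\<lambda>j. nmul j x)"
  define S where "S = T closure_of H"
  have HR: "H \<subseteq> R" unfolding H_def using x(1) by blast
  have HS: "H \<subseteq> S" unfolding S_def using HR by (rule closure_of_subset)
  have clS: "closedin T S" unfolding S_def by simp
  have SR: "S \<subseteq> R" using clS by (rule closedin_subset)
  have 0: "\<zero> \<in> S" using HS nmul.simps(1) unfolding H_def by (metis rangeI subsetD)
  have plus: "u \<oplus> v \<in> S" if "u \<in> S" "v \<in> S" for u v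
    unfolding S_def
  proof (rule closure_of_add)
    show "a \<oplus> b \<in> H" if ab: "a \<in> H" "b \<in> H" for a b
    proof -
      obtain i j where "a = nmul i x" "b = nmul j x" using ab unfolding H_def by blast
      then have "a \<oplus> b = nmul (i + j) x" using x(1) by (simp add: nmul_add)
      then show ?thesis unfolding H_def by blast
    qed
  qed (use HR that in \<open>simp_all add: S_def\<close>)
  have neg: "\<zero> \<ominus> i \<in> S" if i: "i \<in> S" for i
  proof (rule ccontr)
    assume *: "\<zero> \<ominus> i \<notin> S"
    have iR: "i \<in> R" using i SR by blast
    have "openin T {u \<in> R. u \<ominus> i \<in> R - S}"
      using clS iR by (intro openin_translate) auto
    moreover have "\<zero> \<in> {u \<in> R. u \<ominus> i \<in> R - S}" using * iR by simp
    ultimately obtain n where n: "n > 0" "nmul n i \<in> {u \<in> R. u \<ominus> i \<in> R - S}"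
      by (rule recurrence[OF iR])
    obtain m where m: "n = Suc m" using n(1) gr0_conv_Suc by blast
    \<comment> \<open>If \<open>n\<close> times \<open>i\<close> is close to zero, then
      \<open>n - 1\<close> times \<open>i\<close> is close to the negative of
      \<open>i\<close>.\<close>
    have "nmul n i \<ominus> i = nmul m i"
      unfolding m using iR by (intro diff_unique) auto
    moreover have "nmul m i \<in> S" using 0 plus i by (rule nmul_in_submonoid)
    ultimately show False using n(2) by simp
  qed
  have "S = {\<zero>} \<or> S = R"
  proof (rule subtractive_ideal_trivial)
    show "closed_ideal S"
      unfolding closed_ideal_def
    proof (intro conjI ballI)
      show "closedin T S" "\<zero> \<in> S" by fact+
      show "u \<oplus> v \<in> S" if "u \<in> S" "v \<in> S" for u v using that by (rule plus)
      show "a \<odot> u \<in> S" "u \<odot> a \<in> S" if "u \<in> S" "a \<in> R" for u a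
        using mul0[of a u] mul0[of u a] that SR 0 by (simp_all add: subset_iff)
    qed
    fix u i assume u: "u \<in> R" and i: "i \<in> S" and ui: "u \<oplus> i \<in> S"
    have iR: "i \<in> R" using i SR by blast
    have "(u \<oplus> i) \<oplus> (\<zero> \<ominus> i) = u"
      using u iR by (simp add: add_assoc add_diff)
    then show "u \<in> S" using plus[OF ui neg[OF i]] by simp
  qed
  moreover have "S \<subseteq> V"
    unfolding S_def H_def using V(1) x(2) by (intro closure_of_minimal) auto
  then have "S \<noteq> R" using V closedin_subset by blast
  ultimately have "S = {\<zero>}" by blast
  moreover have "x \<in> S" using HS x(1) nmul_1 unfolding H_def by (metis rangeI subsetD)
  ultimately show ?thesis by simp
qed

text \<open>Otherwise the nested compact sets \<open>multiples_in k V - U\<close> share a point, all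
  of whose multiples stay in \<open>V\<close>; that point must be zero, which lies in
  \<open>U\<close>.\<close>

lemma multiples_in_small:
  assumes mul0: "\<And>x y. x \<in> R \<Longrightarrow> y \<in> R \<Longrightarrow> x \<odot> y = \<zero>"
    and V: "closedin T V" "V \<noteq> R" and U: "openin T U" "\<zero> \<in> U"
  obtains k where "multiples_in k V \<subseteq> U"
proof -
  have "\<exists>k. multiples_in k V - U = {}"
  proof (rule ccontr)
    assume "\<not> ?thesis"
    then have ne: "multiples_in k V - U \<noteq> {}" for k by blast
    have "(\<Inter>k. multiples_in k V - U) \<noteq> {}"
    proof (rule compact_space_imp_nest[OF compact _ ne])
      show "closedin T (multiples_in k V - U)" for k
        using closedin_multiples_in[OF V(1)] U(1) by (rule closedin_diff)
      show "decseq (\<lambda>k. multiples_in k V - U)"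
        unfolding decseq_def using multiples_in_mono by blast
    qed
    then obtain x where x: "\<And>k. x \<in> multiples_in k V" "x \<notin> U" by blast
    then have "x = \<zero>"
      using no_small_submonoid[OF mul0 V, of x] unfolding multiples_in_def by blast
    then show False using x(2) U(2) by blast
  qed
  then show thesis using that by blast
qed

text \<open>With trivial multiplication there are no small subgroups, so division by a suitable integer
  contracts a neighbourhood of zero; the points it attracts form an open subgroup, and if that is
  everything then compactness makes a power of the contraction map the whole group into a proper
  neighbourhood.\<close>

lemma finite_if_divisible:
  assumes div: "\<And>n. n > 0 \<Longrightarrow> nmul n ` R = R"
    and tf: "\<And>n x. n > 0 \<Longrightarrow> x \<in> R \<Longrightarrow> nmul n x = \<zero> \<Longrightarrow> x = \<zero>"
  shows "finite R"
proof (cases "R = {\<zero>}")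
  case True
  then show ?thesis by (metis finite.emptyI finite_insert)
next
  case False
  have mul0: "x \<odot> y = \<zero>" if "x \<in> R" "y \<in> R" for x y
    using div that by (rule mul_zero_if_divisible)
  have inj: "x = y" if "n > 0" "x \<in> R" "y \<in> R" "nmul n x = nmul n y" for n x y
  proof -
    have "nmul n (x \<ominus> y) = \<zero>" using that by (simp add: nmul_diff)
    then have "x \<ominus> y = \<zero>" using tf that by blast
    then show ?thesis using add_diff[of x y] that by simp
  qed
  obtain x1 where x1: "x1 \<in> R" "x1 \<noteq> \<zero>" using False zero_closed by blast
  have "openin T (R - {x1})" "\<zero> \<in> R - {x1}" using openin_delete x1 by auto
  \<comment> \<open>Two scales: \<open>V2\<close> avoids \<open>x1\<close>, and the set
    \<open>V\<close> chosen below is so small that sums of two of its elements stay in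
    \<open>V2\<close>.\<close>
  then obtain N2 V2 where N2: "openin T N2" "closedin T V2" "\<zero> \<in> N2" "N2 \<subseteq> V2" "V2 \<subseteq> R - {x1}"
    by (rule closed_nbhd)
  have "continuous_map (prod_topology T T) T (\<lambda>p. fst p \<oplus> snd p)"
    by (rule cont_intros)+
  then obtain N where N: "openin T N" "\<zero> \<in> N" "\<And>x y. x \<in> N \<Longrightarrow> y \<in> N \<Longrightarrow> x \<oplus> y \<in> N2"
    using square_nbhd[of "(\<oplus>)" N2 \<zero>] N2 by auto
  obtain V0 V where V: "openin T V0" "closedin T V" "\<zero> \<in> V0" "V0 \<subseteq> V" "V \<subseteq> N"
    using closed_nbhd[OF N(1,2)] by blast
  have V2R: "V2 \<noteq> R" using N2(5) x1 by blast
  have "x1 \<notin> V"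
  proof
    assume "x1 \<in> V"
    then have "x1 \<oplus> \<zero> \<in> N2" using V(5) N by blast
    then show False using N2 x1 by auto
  qed
  then have VR: "V \<noteq> R" using x1 by blast
  obtain k0 where k0: "multiples_in k0 V2 \<subseteq> V0"
    using multiples_in_small[OF mul0 N2(2) V2R V(1,3)] by blast
  \<comment> \<open>Keeping \<open>K\<close> multiples in \<open>V2\<close> forces membership in
    \<open>V\<close>. In \<open>M\<close> the factor \<open>K\<close> pays for this return from
    \<open>V2\<close> to \<open>V\<close>, and the factor 2 is the net gain.\<close>
  define K where "K = Suc k0"
  define M where "M = 2 * K"
  have K: "multiples_in K V2 \<subseteq> V" using k0 multiples_in_mono[of k0 K V2] V(4) unfolding K_def by auto
  have Mpos: "M > 0" unfolding M_def K_def by simp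
  define O2 where "O2 = multiples_in M N"
  have O2: "openin T O2" "\<zero> \<in> O2" unfolding O2_def using N openin_multiples_in by (auto simp: multiples_in_def)
  \<comment> \<open>A closed set missing zero, by torsion-freeness. So an element whose
    \<open>M\<close>-fold is close enough to zero lies in \<open>O2\<close>: division by
    \<open>M\<close> is continuous at zero.\<close>
  define D where "D = nmul M ` (R - O2)"
  have "closedin T D" unfolding D_def
    using O2(1) by (intro closedin_image continuous_map_nmul) auto
  moreover have "\<zero> \<notin> D"
    unfolding D_def using tf[OF Mpos] O2(2) by force
  ultimately have "openin T (R - D)" "\<zero> \<in> R - D" by auto
  then obtain k1 where k1: "multiples_in k1 V \<subseteq> R - D"
    using multiples_in_small[OF mul0 V(2) VR] by blast
  \<comment> \<open>The successor makes \<open>kk\<close> positive, so that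
    \<open>multiples_in kk V\<close> lies in \<open>V\<close>.\<close>
  define kk where "kk = Suc k1"
  \<comment> \<open>Division by \<open>M\<close> doubles the number of multiples kept in
    \<open>V\<close>. For \<open>j \<le> M * k\<close>, division with remainder writes
    \<open>nmul j y\<close> as a sum of two elements of \<open>N\<close>, hence in
    \<open>V2\<close>; for \<open>j \<le> 2 * k\<close> the first \<open>K\<close> multiples of
    \<open>nmul j y\<close> are of this kind, which puts it back into \<open>V\<close>.\<close>
  have claim: "y \<in> multiples_in (2 * k) V" if k: "k \<ge> k1" and y: "y \<in> R" and My: "nmul M y \<in> multiples_in k V" for k y
  proof -
    have "nmul M y \<notin> D" using My k1 multiples_in_mono[OF k, of V] by blast
    then have yO: "y \<in> O2" unfolding D_def using y by blast
    have in2: "nmul j y \<in> V2" if j: "j \<le> M * k" for j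
    proof -
      have "j div M \<le> k" using j Mpos by (metis div_le_mono nonzero_mult_div_cancel_left not_gr_zero)
      then have "nmul (j div M) (nmul M y) \<in> N" using My V(5) unfolding multiples_in_def by auto
      moreover have "nmul (j mod M) y \<in> N"
        using yO Mpos unfolding O2_def multiples_in_def by auto
      ultimately have "nmul (j div M) (nmul M y) \<oplus> nmul (j mod M) y \<in> N2" by (rule N(3))
      moreover have "nmul (j div M) (nmul M y) \<oplus> nmul (j mod M) y = nmul j y"
        using nmul_add[OF y, of "j div M * M" "j mod M"] nmul_mult[OF y, of "j div M" M] by simp
      ultimately show ?thesis using N2(4) by auto
    qed
    have "nmul j y \<in> V" if j: "j \<le> 2 * k" for j
    proof -
      have "nmul i (nmul j y) \<in> V2" if "i \<le> K" for i
      proof -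
        have "i * j \<le> K * (2 * k)" using that j by (rule mult_le_mono)
        then have "i * j \<le> M * k" unfolding M_def by (simp add: mult_ac)
        then show ?thesis using in2[of "i * j"] nmul_mult[OF y, of i j] by simp
      qed
      then have "nmul j y \<in> multiples_in K V2" unfolding multiples_in_def using y by simp
      then show ?thesis using K by blast
    qed
    then show ?thesis unfolding multiples_in_def using y by simp
  qed
  have iter: "y \<in> multiples_in (2 ^ l * kk) V" if "y \<in> R" "nmul (M ^ l) y \<in> multiples_in kk V" for l y
    using that
  proof (induction l arbitrary: y)
    case (Suc l)
    have "nmul (M ^ l) (nmul M y) \<in> multiples_in kk V"
      using Suc.prems nmul_mult[of y "M ^ l" M] by (simp add: mult.commute)
    then have "nmul M y \<in> multiples_in (2 ^ l * kk) V" using Suc by simp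
    moreover have "k1 \<le> 2 ^ l * kk"
    proof -
      have "kk \<le> 2 ^ l * kk" by simp
      then show ?thesis unfolding kk_def by simp
    qed
    ultimately have "y \<in> multiples_in (2 * (2 ^ l * kk)) V" using claim Suc.prems by blast
    then show ?case by (simp add: mult_ac)
  qed simp
  define Q where "Q = multiples_in kk V"
  define QO where "QO = multiples_in kk V0"
  have QO: "openin T QO" "\<zero> \<in> QO" "QO \<subseteq> Q"
    unfolding QO_def Q_def using openin_multiples_in V(1,3,4) by (auto simp: multiples_in_def)
  have QR: "Q \<subseteq> R" unfolding Q_def multiples_in_def by auto
  \<comment> \<open>The points that repeated division by \<open>M\<close> brings into
    \<open>Q\<close>; \<open>attract\<close> shows that further division drives them to
    zero.\<close>
  define S where "S = {x \<in> R. \<exists>i. \<exists>y\<in>Q. nmul (M ^ i) y = x}"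
  have attract: "\<exists>i0. \<forall>i\<ge>i0. \<exists>y\<in>U \<inter> Q. nmul (M ^ i) y = x"
    if x: "x \<in> S" and U: "openin T U" "\<zero> \<in> U" for x U
  proof -
    obtain i y where iy: "y \<in> Q" "nmul (M ^ i) y = x" using x unfolding S_def by blast
    obtain k where k: "multiples_in k V \<subseteq> U"
      using multiples_in_small[OF mul0 V(2) VR U] by blast
    have "\<exists>y'\<in>U \<inter> Q. nmul (M ^ i') y' = x" if i': "i' \<ge> i + k" for i'
    proof -
      \<comment> \<open>Dividing \<open>l\<close> more times keeps \<open>2 ^ l\<close> times as
        many multiples in \<open>V\<close>, eventually more than the \<open>k\<close> that force
        membership in \<open>U\<close>.\<close>
      define l where "l = i' - i"
      have l: "i' = i + l" "l \<ge> k" using i' unfolding l_def by auto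
      have "y \<in> nmul (M ^ l) ` R" using div[of "M ^ l"] Mpos iy QR by auto
      then obtain y' where y': "y' \<in> R" "y = nmul (M ^ l) y'" by blast
      have "y' \<in> multiples_in (2 ^ l * kk) V" using iter[OF y'(1)] y' iy unfolding Q_def by blast
      moreover have "k \<le> 2 ^ l * kk"
      proof -
        have "k \<le> 2 ^ l" using l(2) less_exp[of l] by linarith
        also have "\<dots> \<le> 2 ^ l * kk" unfolding kk_def by simp
        finally show ?thesis .
      qed
      moreover have "kk \<le> 2 ^ l * kk" by simp
      ultimately have "y' \<in> U \<inter> Q" using k multiples_in_mono unfolding Q_def by blast
      moreover have "nmul (M ^ i') y' = x"
        unfolding l power_add using nmul_mult[OF y'(1)] iy y' by simp
      ultimately show ?thesis by blast
    qed
    then show ?thesis by blast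
  qed
  have QS: "Q \<subseteq> S"
  proof
    fix x assume "x \<in> Q"
    moreover then have "nmul (M ^ 0) x = x" using QR by auto
    ultimately show "x \<in> S" unfolding S_def using QR by blast
  qed
  have S_diff: "x \<ominus> x' \<in> S" if x: "x \<in> S" "x' \<in> S" for x x'
  proof -
    \<comment> \<open>Both points are divided by one common power of \<open>M\<close>, high enough
      that the difference of the quotients lies in \<open>QO\<close>.\<close>
    obtain O1 where O1: "openin T O1" "\<zero> \<in> O1" "\<And>x y. x \<in> O1 \<Longrightarrow> y \<in> O1 \<Longrightarrow> x \<ominus> y \<in> QO"
      using diff_nbhd[OF QO(1,2)] by blast
    obtain i where i: "\<forall>j\<ge>i. \<exists>y\<in>O1 \<inter> Q. nmul (M ^ j) y = x" using attract[OF x(1) O1(1,2)] by blast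
    obtain i' where i': "\<forall>j\<ge>i'. \<exists>y\<in>O1 \<inter> Q. nmul (M ^ j) y = x'" using attract[OF x(2) O1(1,2)] by blast
    obtain y where y: "y \<in> O1" "y \<in> Q" "nmul (M ^ max i i') y = x" using i by (metis IntE max.cobounded1)
    obtain y' where y': "y' \<in> O1" "y' \<in> Q" "nmul (M ^ max i i') y' = x'" using i' by (metis IntE max.cobounded2)
    have R: "y \<in> R" "y' \<in> R" using y y' QR by auto
    have "y \<ominus> y' \<in> Q" using O1(3) y y' QO(3) by blast
    moreover have "nmul (M ^ max i i') (y \<ominus> y') = x \<ominus> x'" using R y y' by (simp add: nmul_diff)
    moreover have "x \<ominus> x' \<in> R" using x unfolding S_def by auto
    ultimately show ?thesis unfolding S_def by blast
  qed
  have SR: "S \<subseteq> R" unfolding S_def by blast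
  have 0: "\<zero> \<in> S" using QS QO by blast
  have S_add: "x \<oplus> q \<in> S" if "x \<in> S" "q \<in> S" for x q
  proof -
    have R: "x \<in> R" "q \<in> R" using that SR by auto
    have "x \<ominus> (\<zero> \<ominus> q) = x \<oplus> q"
    proof (rule diff_unique)
      have "(\<zero> \<ominus> q) \<oplus> (x \<oplus> q) = x \<oplus> (q \<oplus> (\<zero> \<ominus> q))"
        using R by (simp add: add_ac)
      then show "(\<zero> \<ominus> q) \<oplus> (x \<oplus> q) = x" using R by (simp add: add_diff)
    qed (use R in auto)
    then show ?thesis using S_diff[OF that(1) S_diff[OF 0 that(2)]] by simp
  qed
  have coset: "openin T {y \<in> R. y \<ominus> x \<in> QO}" "x \<in> {y \<in> R. y \<ominus> x \<in> QO}" if "x \<in> R" for x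
    using openin_translate[OF QO(1) that] that QO(2) by auto
  have "openin T S"
  proof (subst openin_subopen, intro ballI)
    fix x assume x: "x \<in> S"
    then have xR: "x \<in> R" using SR by blast
    have "{y \<in> R. y \<ominus> x \<in> QO} \<subseteq> S"
    proof
      fix y assume "y \<in> {y \<in> R. y \<ominus> x \<in> QO}"
      then have y: "y \<in> R" "y \<ominus> x \<in> S" using QO(3) QS by auto
      then show "y \<in> S" using S_add[OF x y(2)] add_diff[OF y(1) xR] by simp
    qed
    then show "\<exists>U. openin T U \<and> x \<in> U \<and> U \<subseteq> S" using coset[OF xR] by blast
  qed
  moreover have "closedin T S"
  proof -
    have "openin T (R - S)"
    proof (subst openin_subopen, intro ballI)
      fix x assume x: "x \<in> R - S"
      then have xR: "x \<in> R" by blast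
      have "{y \<in> R. y \<ominus> x \<in> QO} \<subseteq> R - S"
      proof
        fix y assume "y \<in> {y \<in> R. y \<ominus> x \<in> QO}"
        then have y: "y \<in> R" "y \<ominus> x \<in> S" using QO(3) QS by auto
        have "y \<ominus> (y \<ominus> x) = x"
          using y xR add_diff[OF y(1) xR] by (intro diff_unique) (auto simp: add_commute)
        then have "y \<notin> S" using S_diff[OF _ y(2), of y] x by auto
        then show "y \<in> R - S" using y by blast
      qed
      then show "\<exists>U. openin T U \<and> x \<in> U \<and> U \<subseteq> R - S" using coset[OF xR] by blast
    qed
    then show ?thesis using SR by (simp add: closedin_def)
  qed
  moreover have "S \<noteq> R"
  proof
    assume "S = R"
    define B where "B = (\<lambda>i. nmul (M ^ i) ` QO)"
    have Mi: "M ^ i > 0" for i using Mpos by simp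
    \<comment> \<open>A continuous bijection of the compact Hausdorff space \<open>R\<close>
      preserves closed sets and so, through complements, open ones.\<close>
    have opB: "openin T (B i)" for i
    proof -
      have "closedin T (nmul (M ^ i) ` (R - QO))"
        using QO(1) by (intro closedin_image continuous_map_nmul) auto
      moreover have "nmul (M ^ i) ` (R - QO) = R - B i"
      proof -
        have "inj_on (nmul (M ^ i)) R" using inj[OF Mi] by (intro inj_onI) blast
        then have "nmul (M ^ i) ` (R - QO) = nmul (M ^ i) ` R - nmul (M ^ i) ` QO"
          by (rule inj_on_image_set_diff) (use QO QR in auto)
        then show ?thesis unfolding B_def using div[OF Mi] by simp
      qed
      moreover have "B i \<subseteq> R" unfolding B_def using QO QR by auto
      ultimately show ?thesis by (simp add: openin_closedin_eq)
    qed
    have "R \<subseteq> \<Union>(range B)"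
    proof
      fix x assume "x \<in> R"
      then obtain i where "\<exists>y\<in>QO \<inter> Q. nmul (M ^ i) y = x"
        using attract[OF _ QO(1,2), of x] \<open>S = R\<close> by blast
      then show "x \<in> \<Union>(range B)" unfolding B_def by blast
    qed
    then obtain \<F> where "finite \<F>" "\<F> \<subseteq> range B" "R \<subseteq> \<Union>\<F>"
      using compact opB unfolding compact_space_alt by (metis (no_types, lifting) imageE)
    then obtain I where I: "finite I" "R \<subseteq> (\<Union>i\<in>I. B i)"
      using finite_subset_image[of \<F> B UNIV] by auto
    define m where "m = Max (insert 0 I)"
    \<comment> \<open>The finite cover is applied to \<open>nmul (M ^ m) x1\<close>. Cancelling
      \<open>M ^ i\<close> with \<open>i \<le> m\<close> leaves a multiple of \<open>x1\<close> in
      \<open>Q\<close>, and dividing back by the remaining power puts \<open>x1\<close> itself into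
      \<open>Q\<close>, hence into \<open>V\<close>.\<close>
    have "x1 \<in> Q"
    proof -
      have "nmul (M ^ m) x1 \<in> R" using x1 by blast
      then obtain i y where iy: "i \<in> I" "y \<in> QO" "nmul (M ^ m) x1 = nmul (M ^ i) y"
        using I(2) unfolding B_def by blast
      have yR: "y \<in> R" using iy QO QR by blast
      have "i \<le> m" unfolding m_def using I iy by simp
      then have "nmul (M ^ m) x1 = nmul (M ^ i) (nmul (M ^ (m - i)) x1)"
        using nmul_mult[OF x1(1), of "M ^ i" "M ^ (m - i)"] by (simp flip: power_add)
      then have "nmul (M ^ i) (nmul (M ^ (m - i)) x1) = nmul (M ^ i) y"
        using iy(3) by (rule trans[OF sym])
      then have "nmul (M ^ (m - i)) x1 = y"
        by (rule inj[OF Mi nmul_closed[OF x1(1)] yR])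
      then have "nmul (M ^ (m - i)) x1 \<in> multiples_in kk V" using iy QO(3) unfolding Q_def by blast
      then have "x1 \<in> multiples_in (2 ^ (m - i) * kk) V" using iter x1 by blast
      moreover have "kk \<le> 2 ^ (m - i) * kk" by simp
      ultimately show ?thesis unfolding Q_def using multiples_in_mono by blast
    qed
    then have "nmul (Suc 0) x1 \<in> V" unfolding Q_def kk_def multiples_in_def by blast
    then show False using \<open>x1 \<notin> V\<close> x1 by simp
  qed
  then obtain x2 where "x2 \<in> R" "x2 \<notin> S" using SR by blast
  ultimately show ?thesis using finite_if_clopen[of S \<zero> x2] 0 by blast
qed

end

section \<open>Finiteness\<close>

lemma (in simple_compact_semiring) finite_carrier: "finite R"
proof (cases rule: ring_or_antisym)
  case 1
  then interpret simple_compact_ring T add mul z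
    by unfold_locales
  show ?thesis
  proof (cases "\<exists>n>0. \<forall>x\<in>R. nmul n x = \<zero>")
    case True
    then show ?thesis using finite_if_torsion by blast
  next
    case False
    then have "(\<forall>x\<in>R. nmul n x = \<zero> \<longrightarrow> x = \<zero>) \<and> nmul n ` R = R" if "n > 0" for n
      using torsion_dichotomy[OF that] that by blast
    then show ?thesis by (intro finite_if_divisible) blast+
  qed
next
  case 2
  then show ?thesis by (rule finite_if_antisym)
qed

theorem theorem4p6:
  fixes T :: "'a topology" and add mul :: "'a \<Rightarrow> 'a \<Rightarrow> 'a" and z :: 'a
  assumes "simple_top_semiring T add mul z"
    and "compact_space T"
  shows "finite (topspace T)"
  using simple_compact_semiringI[OF assms] by (rule simple_compact_semiring.finite_carrier)

end
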